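(* Let $(R,S,\pi,\cdot)$ be a crossed module of shelves. (Set-theoretic version) Any set-theoretic representations $(M_i,\blacktriangleleft_i,gr_i)$, $1\le i\le n$, of $(R,S,\pi,\cdot)$ form a braided system in the category of sets (with the Cartesian product, written $\otimes$), with the braidings $$\sigma(m\otimes n)=n\otimes \bigl(m\blacktriangleleft_i\pi(gr_j(n))\bigr)\qquad\text{on } M_i\otimes M_j .$$ (Linear version) Any linear representations $M_i$ of $(R,S,\pi,\cdot)$ over a field $\Bbbk$ form a braided system in the category of $\Bbbk$-vector spaces, with the braidings $\sigma(m\otimes n)=\sum_{r\in R}n_r\otimes (m\blacktriangleleft_i\pi(r))$ on $M_i\otimes M_j$, where $n_r$ is the degree $r$ component of $n$.
   Context: A shelf is a set $S$ with a binary operation $\lhd$ satisfying $(a\lhd b)\lhd c=(a\lhd c)\lhd(b\lhd c)$; shelf morphisms are maps preserving $\lhd$. For a shelf $S$, an $S$-module in sets (resp. in $\Bbbk$-vector spaces) is a set (resp. vector space) $M$ with a map $\blacktriangleleft\colon M\times S\to M$ (linear in $M$ in the linear case) satisfying $(m\blacktriangleleft s)\blacktriangleleft s'=(m\blacktriangleleft s')\blacktriangleleft(s\lhd s')$; such a map is called a shelf action. A crossed module of shelves $(R,S,\pi,\cdot)$ consists of shelves $R,S$, a shelf morphism $\pi\colon R\to S$ and a shelf action $\cdot$ of $S$ on $R$ by shelf morphisms, with $r\cdot\pi(r')=r\lhd r'$ and $\pi(r\cdot s)=\pi(r)\lhd s$. A set-theoretic (resp. linear) representation of $(R,S,\pi,\cdot)$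 is an $S$-module $(M,\blacktriangleleft)$ in sets (resp. vector spaces) with an $R$-grading, i.e. a map $gr\colon M\to R$ with $M_r=gr^{-1}(r)$ (resp. a decomposition $M=\bigoplus_{r\in R}M_r$), such that $M_r\blacktriangleleft s\subseteq M_{r\cdot s}$ for all $r\in R,s\in S$. A braided system in a strict monoidal category is a family of objects $V_1,\dots,V_n$ with morphisms $\sigma_{i,j}\colon V_i\otimes V_j\to V_j\otimes V_i$, $i\le j$, satisfying for all $i\le j\le k$: $(\sigma_{j,k}\otimes V_i)\circ(V_j\otimes\sigma_{i,k})\circ(\sigma_{i,j}\otimes V_k)=(V_k\otimes\sigma_{i,j})\circ(\sigma_{i,k}\otimes V_j)\circ(V_i\otimes\sigma_{j,k})$ (an object's name also denotes its identity; associativity isomorphisms of sets and vector spaces are treated as identities). Braidings need not be invertible. *)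

theory Defs
  imports "HOL-Algebra.AbelCoset" "Jordan_Normal_Form.Missing_VectorSpace"
begin

section \<open>Shelves, shelf actions and crossed modules of shelves\<close>

locale shelf =
  fixes S :: "'s set" and tri :: "'s \<Rightarrow> 's \<Rightarrow> 's"  (infixl \<open>\<triangleleft>\<close> 70)
  assumes closed: "\<lbrakk>a \<in> S; b \<in> S\<rbrakk> \<Longrightarrow> a \<triangleleft> b \<in> S"
    and self_distrib:
      "\<lbrakk>a \<in> S; b \<in> S; c \<in> S\<rbrakk> \<Longrightarrow> (a \<triangleleft> b) \<triangleleft> c = (a \<triangleleft> c) \<triangleleft> (b \<triangleleft> c)"

locale shelf_hom = source: shelf R triR + target: shelf S triS
  for R :: "'r set" and triR and S :: "'s set" and triS +
  fixes f :: "'r \<Rightarrow> 's"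
  assumes maps_to: "f \<in> R \<rightarrow> S"
    and hom: "\<lbrakk>a \<in> R; b \<in> R\<rbrakk> \<Longrightarrow> f (triR a b) = triS (f a) (f b)"

locale shelf_set_module = shelf S tri
  for S :: "'s set" and tri +
  fixes M :: "'m set" and mact :: "'m \<Rightarrow> 's \<Rightarrow> 'm"
  assumes mact_closed: "\<lbrakk>m \<in> M; s \<in> S\<rbrakk> \<Longrightarrow> mact m s \<in> M"
    and mact_mact:
      "\<lbrakk>m \<in> M; s \<in> S; s' \<in> S\<rbrakk> \<Longrightarrow> mact (mact m s) s' = mact (mact m s') (tri s s')"

locale shelf_linear_module = shelf S tri + vectorspace K M
  for S :: "'s set" and tri and K :: "'k ring" and M :: "('k, 'm) module" +
  fixes mact :: "'m \<Rightarrow> 's \<Rightarrow> 'm"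
  assumes mact_linear: "s \<in> S \<Longrightarrow> linear_map K M M (\<lambda>m. mact m s)"
    and mact_mact:
      "\<lbrakk>m \<in> carrier M; s \<in> S; s' \<in> S\<rbrakk> \<Longrightarrow>
        mact (mact m s) s' = mact (mact m s') (tri s s')"

locale shelf_crossed_module =
  shelf_hom R triR S triS \<pi> + action: shelf_set_module S triS R act
  for R :: "'r set" and triR and S :: "'s set" and triS
    and \<pi> :: "'r \<Rightarrow> 's" and act :: "'r \<Rightarrow> 's \<Rightarrow> 'r" +
  assumes act_hom: "s \<in> S \<Longrightarrow> shelf_hom R triR R triR (\<lambda>r. act r s)"
    and act_\<pi>: "\<lbrakk>r \<in> R; r' \<in> R\<rbrakk> \<Longrightarrow> act r (\<pi> r') = triR r r'"
    and \<pi>_act: "\<lbrakk>r \<in> R; s \<in> S\<rbrakk> \<Longrightarrow> \<pi> (act r s) = triS (\<pi> r) s"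


section \<open>Representations\<close>

locale set_representation =
  shelf_crossed_module R triR S triS \<pi> act + shelf_set_module S triS M mact
  for R :: "'r set" and triR and S :: "'s set" and triS and \<pi> and act
    and M :: "'m set" and mact +
  fixes gr :: "'m \<Rightarrow> 'r"
  assumes gr: "gr \<in> M \<rightarrow> R"
    and graded: "\<lbrakk>r \<in> R; s \<in> S\<rbrakk> \<Longrightarrow>
      (\<lambda>m. mact m s) ` {m \<in> M. gr m = r} \<subseteq> {m \<in> M. gr m = act r s}"

text \<open>
  \<open>homogeneous_components V I W v c\<close>: the family \<open>c\<close> has \<open>c i \<in> W i\<close>, almost all of its members
  are zero, and it sums to \<open>v\<close>.  As \<^const>\<open>finsum\<close> is zero over infinite index sets, the
  sum is taken over the support of \<open>c\<close>.
\<close>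

definition homogeneous_components ::
    "('k, 'm) module \<Rightarrow> 'i set \<Rightarrow> ('i \<Rightarrow> 'm set) \<Rightarrow> 'm \<Rightarrow> ('i \<Rightarrow> 'm) \<Rightarrow> bool" where
  "homogeneous_components V I W v c \<longleftrightarrow>
     c \<in> (\<Pi>\<^sub>E i\<in>I. W i) \<and> finite {i \<in> I. c i \<noteq> \<zero>\<^bsub>V\<^esub>} \<and>
     v = (\<Oplus>\<^bsub>V\<^esub>i\<in>{i \<in> I. c i \<noteq> \<zero>\<^bsub>V\<^esub>}. c i)"

definition direct_sum_decomposition ::
    "'k ring \<Rightarrow> ('k, 'm) module \<Rightarrow> 'i set \<Rightarrow> ('i \<Rightarrow> 'm set) \<Rightarrow> bool" where
  "direct_sum_decomposition K V I W \<longleftrightarrow>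
     (\<forall>i\<in>I. subspace K (W i) V) \<and>
     (\<forall>v\<in>carrier V. \<exists>!c. homogeneous_components V I W v c)"

definition component ::
    "('k, 'm) module \<Rightarrow> 'i set \<Rightarrow> ('i \<Rightarrow> 'm set) \<Rightarrow> 'm \<Rightarrow> 'i \<Rightarrow> 'm" where
  "component V I W v = (THE c. homogeneous_components V I W v c)"

locale linear_representation =
  shelf_crossed_module R triR S triS \<pi> act + shelf_linear_module S triS K M mact
  for R :: "'r set" and triR and S :: "'s set" and triS and \<pi> and act
    and K :: "'k ring" and M :: "('k, 'm) module" and mact +
  fixes gr :: "'r \<Rightarrow> 'm set"
  assumes grading: "direct_sum_decomposition K M R gr"
    and graded: "\<lbrakk>r \<in> R; s \<in> S\<rbrakk> \<Longrightarrow> (\<lambda>m. mact m s) ` gr r \<subseteq> gr (act r s)"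


section \<open>Tensor products of vector spaces\<close>

definition free_space :: "'k ring \<Rightarrow> 'x set \<Rightarrow> ('k, 'x \<Rightarrow> 'k) module" where
  "free_space K X = (ring.func_space K X)
     \<lparr>carrier := {f \<in> X \<rightarrow>\<^sub>E carrier K. finite {x \<in> X. f x \<noteq> \<zero>\<^bsub>K\<^esub>}}\<rparr>"

definition free_gen :: "'k ring \<Rightarrow> 'x set \<Rightarrow> 'x \<Rightarrow> 'x \<Rightarrow> 'k" where
  "free_gen K X x = (\<lambda>y\<in>X. if y = x then \<one>\<^bsub>K\<^esub> else \<zero>\<^bsub>K\<^esub>)"

text \<open>
  The scalar multiple of a coset \<open>A\<close> is the coset of \<open>c \<odot> a\<close> for any \<open>a \<in> A\<close>.
  (The set of all \<open>c \<odot> a\<close> would not be a coset for \<open>c = \<zero>\<close>.)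
  The ring multiplication and unit of a \<^typ>\<open>('k, 'm) module\<close> record are irrelevant.
\<close>

definition quotient_space :: "('k, 'm) module \<Rightarrow> 'm set \<Rightarrow> ('k, 'm set) module" where
  "quotient_space V N =
     \<lparr>carrier = a_rcosets\<^bsub>V\<^esub> N, mult = (\<lambda>_ _. N), one = N, zero = N,
      add = (<+>\<^bsub>V\<^esub>),
      smult = (\<lambda>c A. \<Union>a\<in>A. N +>\<^bsub>V\<^esub> (c \<odot>\<^bsub>V\<^esub> a))\<rparr>"

definition tensor_relations ::
    "'k ring \<Rightarrow> ('k, 'v) module \<Rightarrow> ('k, 'w) module \<Rightarrow> ('v \<times> 'w \<Rightarrow> 'k) set" where
  "tensor_relations K V W =
    (let F = free_space K (carrier V \<times> carrier W);
         \<delta> = free_gen K (carrier V \<times> carrier W)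
     in {\<delta> (v \<oplus>\<^bsub>V\<^esub> v', w) \<ominus>\<^bsub>F\<^esub> (\<delta> (v, w) \<oplus>\<^bsub>F\<^esub> \<delta> (v', w)) | v v' w.
           v \<in> carrier V \<and> v' \<in> carrier V \<and> w \<in> carrier W} \<union>
        {\<delta> (v, w \<oplus>\<^bsub>W\<^esub> w') \<ominus>\<^bsub>F\<^esub> (\<delta> (v, w) \<oplus>\<^bsub>F\<^esub> \<delta> (v, w')) | v w w'.
           v \<in> carrier V \<and> w \<in> carrier W \<and> w' \<in> carrier W} \<union>
        {\<delta> (c \<odot>\<^bsub>V\<^esub> v, w) \<ominus>\<^bsub>F\<^esub> (c \<odot>\<^bsub>F\<^esub> \<delta> (v, w)) | c v w.
           c \<in> carrier K \<and> v \<in> carrier V \<and> w \<in> carrier W} \<union>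
        {\<delta> (v, c \<odot>\<^bsub>W\<^esub> w) \<ominus>\<^bsub>F\<^esub> (c \<odot>\<^bsub>F\<^esub> \<delta> (v, w)) | c v w.
           c \<in> carrier K \<and> v \<in> carrier V \<and> w \<in> carrier W})"

definition tensor_null ::
    "'k ring \<Rightarrow> ('k, 'v) module \<Rightarrow> ('k, 'w) module \<Rightarrow> ('v \<times> 'w \<Rightarrow> 'k) set" where
  "tensor_null K V W =
     module.span K (free_space K (carrier V \<times> carrier W)) (tensor_relations K V W)"

definition tensor_space ::
    "'k ring \<Rightarrow> ('k, 'v) module \<Rightarrow> ('k, 'w) module \<Rightarrow> ('k, ('v \<times> 'w \<Rightarrow> 'k) set) module" where
  "tensor_space K V W =
     quotient_space (free_space K (carrier V \<times> carrier W)) (tensor_null K V W)"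

definition pure_tensor ::
    "'k ring \<Rightarrow> ('k, 'v) module \<Rightarrow> ('k, 'w) module \<Rightarrow> 'v \<Rightarrow> 'w \<Rightarrow> ('v \<times> 'w \<Rightarrow> 'k) set" where
  "pure_tensor K V W v w =
     tensor_null K V W +>\<^bsub>free_space K (carrier V \<times> carrier W)\<^esub>
       free_gen K (carrier V \<times> carrier W) (v, w)"

text \<open>
  The linear map \<open>V \<otimes> W \<rightarrow> U\<close> induced by a bilinear map \<open>b\<close>.  Extensionality
  makes it unique as a function on the whole type.
\<close>

definition tensor_lift ::
    "'k ring \<Rightarrow> ('k, 'v) module \<Rightarrow> ('k, 'w) module \<Rightarrow> ('k, 'u) module \<Rightarrow>
     ('v \<Rightarrow> 'w \<Rightarrow> 'u) \<Rightarrow> ('v \<times> 'w \<Rightarrow> 'k) set \<Rightarrow> 'u" where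
  "tensor_lift K V W U b =
     (THE h. linear_map K (tensor_space K V W) U h \<and>
             h \<in> extensional (carrier (tensor_space K V W)) \<and>
             (\<forall>v\<in>carrier V. \<forall>w\<in>carrier W. h (pure_tensor K V W v w) = b v w))"

text \<open>\<open>f \<otimes> g\<close> for linear maps \<open>f : V \<rightarrow> V'\<close> and \<open>g : W \<rightarrow> W'\<close>.\<close>

definition tensor_map ::
    "'k ring \<Rightarrow> ('k, 'v) module \<Rightarrow> ('k, 'w) module \<Rightarrow> ('k, 'v') module \<Rightarrow> ('k, 'w') module \<Rightarrow>
     ('v \<Rightarrow> 'v') \<Rightarrow> ('w \<Rightarrow> 'w') \<Rightarrow> ('v \<times> 'w \<Rightarrow> 'k) set \<Rightarrow> ('v' \<times> 'w' \<Rightarrow> 'k) set" where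
  "tensor_map K V W V' W' f g =
     tensor_lift K V W (tensor_space K V' W') (\<lambda>v w. pure_tensor K V' W' (f v) (g w))"

text \<open>
  The canonical isomorphisms \<open>(U \<otimes> V) \<otimes> W \<rightarrow> U \<otimes> (V \<otimes> W)\<close> and back, which are
  determined by their values on \<open>(u \<otimes> v) \<otimes> w\<close> and \<open>u \<otimes> (v \<otimes> w)\<close> respectively.
\<close>

definition tensor_assoc where
  "tensor_assoc K U V W =
     (THE h. linear_map K (tensor_space K (tensor_space K U V) W)
                          (tensor_space K U (tensor_space K V W)) h \<and>
             h \<in> extensional (carrier (tensor_space K (tensor_space K U V) W)) \<and>
             (\<forall>u\<in>carrier U. \<forall>v\<in>carrier V. \<forall>w\<in>carrier W.
                h (pure_tensor K (tensor_space K U V) W (pure_tensor K U V u v) w) =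
                pure_tensor K U (tensor_space K V W) u (pure_tensor K V W v w)))"

definition tensor_assoc_inv where
  "tensor_assoc_inv K U V W =
     (THE h. linear_map K (tensor_space K U (tensor_space K V W))
                          (tensor_space K (tensor_space K U V) W) h \<and>
             h \<in> extensional (carrier (tensor_space K U (tensor_space K V W))) \<and>
             (\<forall>u\<in>carrier U. \<forall>v\<in>carrier V. \<forall>w\<in>carrier W.
                h (pure_tensor K U (tensor_space K V W) u (pure_tensor K V W v w)) =
                pure_tensor K (tensor_space K U V) W (pure_tensor K U V u v) w))"


section \<open>Braided systems\<close>

text \<open>
  In both categories the associativity isomorphisms are written out: the two sides of the
  Yang--Baxter equation are maps \<open>(V\<^sub>i \<otimes> V\<^sub>j) \<otimes> V\<^sub>k \<rightarrow> (V\<^sub>k \<otimes> V\<^sub>j) \<otimes> V\<^sub>i\<close>.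
  Only the \<open>\<sigma> i j\<close> with \<open>1 \<le> i \<le> j \<le> n\<close> matter.
\<close>

definition prod_assoc :: "('a \<times> 'b) \<times> 'c \<Rightarrow> 'a \<times> ('b \<times> 'c)" where
  "prod_assoc = (\<lambda>((a, b), c). (a, (b, c)))"

definition prod_assoc_inv :: "'a \<times> ('b \<times> 'c) \<Rightarrow> ('a \<times> 'b) \<times> 'c" where
  "prod_assoc_inv = (\<lambda>(a, (b, c)). ((a, b), c))"

definition braided_system_set ::
    "nat \<Rightarrow> (nat \<Rightarrow> 'm set) \<Rightarrow> (nat \<Rightarrow> nat \<Rightarrow> 'm \<times> 'm \<Rightarrow> 'm \<times> 'm) \<Rightarrow> bool" where
  "braided_system_set n V \<sigma> \<longleftrightarrow>
     (\<forall>i j. 1 \<le> i \<and> i \<le> j \<and> j \<le> n \<longrightarrow> \<sigma> i j \<in> V i \<times> V j \<rightarrow> V j \<times> V i) \<and>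
     (\<forall>i j k. 1 \<le> i \<and> i \<le> j \<and> j \<le> k \<and> k \<le> n \<longrightarrow>
       (\<forall>x \<in> (V i \<times> V j) \<times> V k.
         (map_prod (\<sigma> j k) id \<circ> prod_assoc_inv \<circ> map_prod id (\<sigma> i k) \<circ> prod_assoc \<circ>
          map_prod (\<sigma> i j) id) x =
         (prod_assoc_inv \<circ> map_prod id (\<sigma> i j) \<circ> prod_assoc \<circ> map_prod (\<sigma> i k) id \<circ>
          prod_assoc_inv \<circ> map_prod id (\<sigma> j k) \<circ> prod_assoc) x))"

definition braided_system_vect ::
    "'k ring \<Rightarrow> nat \<Rightarrow> (nat \<Rightarrow> ('k, 'm) module) \<Rightarrow>
     (nat \<Rightarrow> nat \<Rightarrow> ('m \<times> 'm \<Rightarrow> 'k) set \<Rightarrow> ('m \<times> 'm \<Rightarrow> 'k) set) \<Rightarrow> bool" where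
  "braided_system_vect K n V \<sigma> \<longleftrightarrow>
     (\<forall>i. 1 \<le> i \<and> i \<le> n \<longrightarrow> vectorspace K (V i)) \<and>
     (\<forall>i j. 1 \<le> i \<and> i \<le> j \<and> j \<le> n \<longrightarrow>
       linear_map K (tensor_space K (V i) (V j)) (tensor_space K (V j) (V i)) (\<sigma> i j)) \<and>
     (\<forall>i j k. 1 \<le> i \<and> i \<le> j \<and> j \<le> k \<and> k \<le> n \<longrightarrow>
       (let T = (\<lambda>a b. tensor_space K (V a) (V b)) in
        \<forall>x \<in> carrier (tensor_space K (T i j) (V k)).
         (tensor_map K (T j k) (V i) (T k j) (V i) (\<sigma> j k) id \<circ>
          tensor_assoc_inv K (V j) (V k) (V i) \<circ>
          tensor_map K (V j) (T i k) (V j) (T k i) id (\<sigma> i k) \<circ>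
          tensor_assoc K (V j) (V i) (V k) \<circ>
          tensor_map K (T i j) (V k) (T j i) (V k) (\<sigma> i j) id) x =
         (tensor_assoc_inv K (V k) (V j) (V i) \<circ>
          tensor_map K (V k) (T i j) (V k) (T j i) id (\<sigma> i j) \<circ>
          tensor_assoc K (V k) (V i) (V j) \<circ>
          tensor_map K (T i k) (V j) (T k i) (V j) (\<sigma> i k) id \<circ>
          tensor_assoc_inv K (V i) (V k) (V j) \<circ>
          tensor_map K (V i) (T j k) (V i) (T k j) id (\<sigma> j k) \<circ>
          tensor_assoc K (V i) (V j) (V k)) x))"


section \<open>The braidings attached to representations\<close>

definition set_braiding ::
    "('r \<Rightarrow> 's) \<Rightarrow> ('m \<Rightarrow> 's \<Rightarrow> 'm) \<Rightarrow> ('m' \<Rightarrow> 'r) \<Rightarrow> 'm \<times> 'm' \<Rightarrow> 'm' \<times> 'm" where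
  "set_braiding \<pi> mact gr' = (\<lambda>(m, m'). (m', mact m (\<pi> (gr' m'))))"

text \<open>
  \<open>m \<otimes> m' \<mapsto> \<Sum>\<^sub>r m'\<^sub>r \<otimes> (m \<cdot> \<pi>(r))\<close>; the terms with \<open>m'\<^sub>r = 0\<close> are omitted, so that the sum is
  over a finite set.
\<close>

definition linear_braiding_value ::
    "'r set \<Rightarrow> ('r \<Rightarrow> 's) \<Rightarrow> 'k ring \<Rightarrow> ('k, 'm) module \<Rightarrow> ('m \<Rightarrow> 's \<Rightarrow> 'm) \<Rightarrow>
     ('k, 'm') module \<Rightarrow> ('r \<Rightarrow> 'm' set) \<Rightarrow> 'm \<Rightarrow> 'm' \<Rightarrow> ('m' \<times> 'm \<Rightarrow> 'k) set" where
  "linear_braiding_value R \<pi> K M mact M' gr' m m' =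
     (\<Oplus>\<^bsub>tensor_space K M' M\<^esub>r\<in>{r \<in> R. component M' R gr' m' r \<noteq> \<zero>\<^bsub>M'\<^esub>}.
        pure_tensor K M' M (component M' R gr' m' r) (mact m (\<pi> r)))"

definition linear_braiding ::
    "'r set \<Rightarrow> ('r \<Rightarrow> 's) \<Rightarrow> 'k ring \<Rightarrow> ('k, 'm) module \<Rightarrow> ('m \<Rightarrow> 's \<Rightarrow> 'm) \<Rightarrow>
     ('k, 'm') module \<Rightarrow> ('r \<Rightarrow> 'm' set) \<Rightarrow> ('m \<times> 'm' \<Rightarrow> 'k) set \<Rightarrow> ('m' \<times> 'm \<Rightarrow> 'k) set" where
  "linear_braiding R \<pi> K M mact M' gr' =
     tensor_lift K M M' (tensor_space K M' M) (linear_braiding_value R \<pi> K M mact M' gr')"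

end

theory Submission
  imports Defs
begin

text \<open>
  On sets both sides of the Yang--Baxter equation send \<open>((a, b), c)\<close> to a triple with first entry
  \<open>c\<close> and second entry \<open>b \<cdot> \<pi>(gr c)\<close>.  With \<open>r = gr b\<close> and \<open>t = gr c\<close>, the third entries are
  \<open>(a \<cdot> \<pi>(r)) \<cdot> \<pi>(t)\<close> on the left and \<open>(a \<cdot> \<pi>(t)) \<cdot> \<pi>(gr (b \<cdot> \<pi>(t)))\<close> on the right.
  As \<open>b \<cdot> \<pi>(t)\<close> has degree \<open>r \<cdot> \<pi>(t)\<close> and \<open>\<pi>(r \<cdot> \<pi>(t)) = \<pi>(r) \<lhd> \<pi>(t)\<close>, the two agree by the
  axiom of a shelf action.

  On homogeneous vectors the linear braiding is given by the same formula:
  \<open>m \<otimes> n \<mapsto> n \<otimes> m \<cdot> \<pi>(r)\<close> for \<open>n\<close> of degree \<open>r\<close> (\<open>linear_braiding_homogeneous\<close>).  Both sides of the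
  linear Yang--Baxter equation are linear maps, and the tensors \<open>(u \<otimes> v) \<otimes> w\<close> with \<open>v\<close> and \<open>w\<close>
  homogeneous span \<open>(U \<otimes> V) \<otimes> W\<close>, so the linear version follows from the same computation
  (\<open>linear_yang_baxter\<close>).

  What has to be supplied is the linear algebra behind this reduction.  The tensor product is a
  quotient of a free vector space; its universal property (\<open>tensor_lift\<close>) shows that the maps
  described by their values on pure tensors -- the braiding, \<open>f \<otimes> g\<close>, the associativity
  isomorphisms -- exist and are linear, and spanning sets of the factors give a spanning set of
  the product (\<open>span_pure_tensors\<close>).  The braiding is bilinear before passing to the tensor
  product because the components of a vector depend linearly on it
  (\<open>linear_map_sum_of_components\<close>).
\<close>

section \<open>Linear maps and spanning sets\<close>

lemma linear_mapI:
  assumes "vectorspace K V" "vectorspace K W"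
    and "\<And>v. v \<in> carrier V \<Longrightarrow> f v \<in> carrier W"
    and "\<And>v v'. \<lbrakk>v \<in> carrier V; v' \<in> carrier V\<rbrakk> \<Longrightarrow> f (v \<oplus>\<^bsub>V\<^esub> v') = f v \<oplus>\<^bsub>W\<^esub> f v'"
    and "\<And>c v. \<lbrakk>c \<in> carrier K; v \<in> carrier V\<rbrakk> \<Longrightarrow> f (c \<odot>\<^bsub>V\<^esub> v) = c \<odot>\<^bsub>W\<^esub> f v"
  shows "linear_map K V W f"
  using assms
  by (auto simp: linear_map_def mod_hom_def mod_hom_axioms_def module_hom_def vectorspace_def)

lemma linear_mapD:
  assumes "linear_map K V W f"
  shows "vectorspace K V" "vectorspace K W"
    and "v \<in> carrier V \<Longrightarrow> f v \<in> carrier W"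
    and "\<lbrakk>v \<in> carrier V; v' \<in> carrier V\<rbrakk> \<Longrightarrow> f (v \<oplus>\<^bsub>V\<^esub> v') = f v \<oplus>\<^bsub>W\<^esub> f v'"
    and "\<lbrakk>c \<in> carrier K; v \<in> carrier V\<rbrakk> \<Longrightarrow> f (c \<odot>\<^bsub>V\<^esub> v) = c \<odot>\<^bsub>W\<^esub> f v"
    and "f \<zero>\<^bsub>V\<^esub> = \<zero>\<^bsub>W\<^esub>"
proof -
  interpret f: linear_map K V W f by fact
  show "vectorspace K V" "vectorspace K W" by unfold_locales
  show "v \<in> carrier V \<Longrightarrow> f v \<in> carrier W"
    "\<lbrakk>v \<in> carrier V; v' \<in> carrier V\<rbrakk> \<Longrightarrow> f (v \<oplus>\<^bsub>V\<^esub> v') = f v \<oplus>\<^bsub>W\<^esub> f v'"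
    "\<lbrakk>c \<in> carrier K; v \<in> carrier V\<rbrakk> \<Longrightarrow> f (c \<odot>\<^bsub>V\<^esub> v) = c \<odot>\<^bsub>W\<^esub> f v"
    "f \<zero>\<^bsub>V\<^esub> = \<zero>\<^bsub>W\<^esub>"
    by auto
qed

lemma linear_map_id: "vectorspace K V \<Longrightarrow> linear_map K V V id"
  by (rule linear_mapI) auto

lemma linear_map_comp:
  assumes "linear_map K U V f" "linear_map K V W g"
  shows "linear_map K U W (g \<circ> f)"
  by (rule linear_mapI) (simp_all add: linear_mapD[OF assms(1)] linear_mapD[OF assms(2)])

lemma linear_map_cong:
  assumes "linear_map K V W f" "\<And>v. v \<in> carrier V \<Longrightarrow> g v = f v"
  shows "linear_map K V W g"
proof -
  interpret V: vectorspace K V by (rule linear_mapD(1)[OF assms(1)])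
  show ?thesis by (rule linear_mapI) (simp_all add: assms(2) linear_mapD[OF assms(1)])
qed

lemma linear_map_add:
  assumes "linear_map K V U f" "linear_map K V U g"
  shows "linear_map K V U (\<lambda>v. f v \<oplus>\<^bsub>U\<^esub> g v)"
proof -
  interpret U: vectorspace K U by (rule linear_mapD(2)[OF assms(1)])
  show ?thesis
    using linear_mapD(1)[OF assms(1)] U.vectorspace_axioms
    by (rule linear_mapI)
      (simp_all add: linear_mapD[OF assms(1)] linear_mapD[OF assms(2)] U.smult_r_distr U.M.a_ac)
qed

lemma linear_map_smult:
  assumes "linear_map K V U f" "c \<in> carrier K"
  shows "linear_map K V U (\<lambda>v. c \<odot>\<^bsub>U\<^esub> f v)"
proof -
  interpret U: vectorspace K U by (rule linear_mapD(2)[OF assms(1)])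
  show ?thesis
    using linear_mapD(1)[OF assms(1)] U.vectorspace_axioms
    by (rule linear_mapI)
      (simp_all add: linear_mapD[OF assms(1)] assms(2) U.smult_r_distr U.R.m_comm flip: U.smult_assoc1)
qed

lemma linear_map_zero:
  assumes "vectorspace K V" "vectorspace K U"
  shows "linear_map K V U (\<lambda>v. \<zero>\<^bsub>U\<^esub>)"
proof -
  interpret U: vectorspace K U by fact
  show ?thesis using assms by (rule linear_mapI) simp_all
qed

lemma linear_map_sum:
  assumes "finite A" "\<And>a. a \<in> A \<Longrightarrow> linear_map K V U (f a)" "vectorspace K V" "vectorspace K U"
  shows "linear_map K V U (\<lambda>v. \<Oplus>\<^bsub>U\<^esub>a\<in>A. f a v)"
  using assms(1,2)
proof (induction A)
  case empty
  interpret U: vectorspace K U by fact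
  show ?case using linear_map_zero[OF assms(3,4)] by simp
next
  case (insert a A)
  interpret U: vectorspace K U by fact
  have "linear_map K V U (\<lambda>v. f a v \<oplus>\<^bsub>U\<^esub> (\<Oplus>\<^bsub>U\<^esub>a\<in>A. f a v))"
    using insert by (intro linear_map_add) auto
  then show ?case
  proof (rule linear_map_cong)
    fix v assume "v \<in> carrier V"
    then show "(\<Oplus>\<^bsub>U\<^esub>b\<in>insert a A. f b v) = f a v \<oplus>\<^bsub>U\<^esub> (\<Oplus>\<^bsub>U\<^esub>b\<in>A. f b v)"
      using insert.hyps linear_mapD(3)[OF insert.prems] by (intro U.M.finsum_insert) auto
  qed
qed

lemma subspaceI:
  assumes "vectorspace K V" "N \<subseteq> carrier V" "\<zero>\<^bsub>V\<^esub> \<in> N"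
    and "\<And>v w. \<lbrakk>v \<in> N; w \<in> N\<rbrakk> \<Longrightarrow> v \<oplus>\<^bsub>V\<^esub> w \<in> N"
    and "\<And>c v. \<lbrakk>c \<in> carrier K; v \<in> N\<rbrakk> \<Longrightarrow> c \<odot>\<^bsub>V\<^esub> v \<in> N"
  shows "subspace K N V"
  using assms by (auto simp: subspace_def LinearCombinations.submodule_def vectorspace_def)

lemma subspaceD:
  assumes "subspace K N V"
  shows "vectorspace K V" "N \<subseteq> carrier V" "\<zero>\<^bsub>V\<^esub> \<in> N"
    and "\<lbrakk>v \<in> N; w \<in> N\<rbrakk> \<Longrightarrow> v \<oplus>\<^bsub>V\<^esub> w \<in> N"
    and "\<lbrakk>c \<in> carrier K; v \<in> N\<rbrakk> \<Longrightarrow> c \<odot>\<^bsub>V\<^esub> v \<in> N"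
  using assms by (auto simp: subspace_def LinearCombinations.submodule_def)

lemma subspace_finsum_closed:
  assumes "subspace K N V" "g \<in> A \<rightarrow> N"
  shows "(\<Oplus>\<^bsub>V\<^esub>a\<in>A. g a) \<in> N"
proof -
  interpret V: vectorspace K V by (rule subspaceD(1)[OF assms(1)])
  note N = subspaceD[OF assms(1)]
  show ?thesis using assms(2)
  proof (induction A rule: infinite_finite_induct)
    case (insert a A)
    have "(\<Oplus>\<^bsub>V\<^esub>a\<in>insert a A. g a) = g a \<oplus>\<^bsub>V\<^esub> (\<Oplus>\<^bsub>V\<^esub>a\<in>A. g a)"
      using insert N(2) by (intro V.M.finsum_insert) auto
    then show ?case using insert N(4) by auto
  qed (use N in auto)
qed

lemma subspace_preimage:
  assumes f: "linear_map K V W f" and N: "subspace K N W"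
  shows "subspace K {v \<in> carrier V. f v \<in> N} V"
proof -
  interpret f: linear_map K V W f by fact
  show ?thesis
    by (rule subspaceI) (auto simp: linear_mapD[OF f] subspaceD[OF N])
qed

lemma subspace_equalizer:
  assumes f: "linear_map K V W f" and g: "linear_map K V W g"
  shows "subspace K {v \<in> carrier V. f v = g v} V"
proof -
  interpret f: linear_map K V W f by fact
  show ?thesis
    by (rule subspaceI) (auto simp: linear_mapD[OF f] linear_mapD[OF g])
qed

text \<open>
  Stated with subspaces, spanning can be checked by taking preimages of a subspace under linear
  maps; no linear combination has to be written down.
\<close>

lemma span_eq_carrierI:
  assumes "vectorspace K V" "A \<subseteq> carrier V"
    and "\<And>N. \<lbrakk>subspace K N V; A \<subseteq> N\<rbrakk> \<Longrightarrow> carrier V \<subseteq> N"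
  shows "module.span K V A = carrier V"
proof -
  interpret V: vectorspace K V by fact
  show ?thesis
    using assms(3)[OF V.span_is_subspace[OF assms(2)] V.in_own_span[OF assms(2)]]
      V.span_is_subset2[OF assms(2)] by auto
qed

lemma span_carrier: "vectorspace K X \<Longrightarrow> module.span K X (carrier X) = carrier X"
  by (rule span_eq_carrierI) auto

lemma span_subset_subspace:
  assumes "subspace K N V" "A \<subseteq> N"
  shows "module.span K V A \<subseteq> N"
proof -
  interpret V: vectorspace K V by (rule subspaceD(1)[OF assms(1)])
  show ?thesis using assms by (intro V.span_is_subset) (auto simp: subspace_def)
qed

text \<open>
  The vectors on which two linear maps agree form a subspace.
\<close>

lemma linear_map_eq_on_span:
  assumes "linear_map K V W f" "linear_map K V W g"
    and "A \<subseteq> carrier V" "\<And>a. a \<in> A \<Longrightarrow> f a = g a"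
    and "v \<in> module.span K V A"
  shows "f v = g v"
  using span_subset_subspace[OF subspace_equalizer[OF assms(1,2)], of A] assms(3-5) by auto

section \<open>Free vector spaces\<close>

context
  fixes K :: "'k ring" and X :: "'x set"
  assumes K: "field K"
begin

interpretation K: field K by (rule K)

lemma free_space_simps:
  "carrier (free_space K X) = {f \<in> X \<rightarrow>\<^sub>E carrier K. finite {x \<in> X. f x \<noteq> \<zero>\<^bsub>K\<^esub>}}"
  "\<zero>\<^bsub>free_space K X\<^esub> = (\<lambda>x\<in>X. \<zero>\<^bsub>K\<^esub>)"
  "f \<oplus>\<^bsub>free_space K X\<^esub> g = (\<lambda>x\<in>X. f x \<oplus>\<^bsub>K\<^esub> g x)"
  "c \<odot>\<^bsub>free_space K X\<^esub> f = (\<lambda>x\<in>X. c \<otimes>\<^bsub>K\<^esub> f x)"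
  by (simp_all add: free_space_def K.func_space_def)

lemma vectorspace_free_space: "vectorspace K (free_space K X)"
proof -
  have vs: "vectorspace K (K.func_space X)"
    using K.func_space_is_module K by (simp add: vectorspace_def)
  interpret F: vectorspace K "K.func_space X" by (rule vs)
  have "subspace K {f \<in> X \<rightarrow>\<^sub>E carrier K. finite {x \<in> X. f x \<noteq> \<zero>\<^bsub>K\<^esub>}} (K.func_space X)"
  proof (rule subspaceI[OF vs])
    fix f g assume f: "f \<in> {f \<in> X \<rightarrow>\<^sub>E carrier K. finite {x \<in> X. f x \<noteq> \<zero>\<^bsub>K\<^esub>}}"
      and g: "g \<in> {f \<in> X \<rightarrow>\<^sub>E carrier K. finite {x \<in> X. f x \<noteq> \<zero>\<^bsub>K\<^esub>}}"
    have "finite ({x \<in> X. f x \<noteq> \<zero>\<^bsub>K\<^esub>} \<union> {x \<in> X. g x \<noteq> \<zero>\<^bsub>K\<^esub>})"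
      using f g by auto
    then have "finite {x \<in> X. f x \<oplus>\<^bsub>K\<^esub> g x \<noteq> \<zero>\<^bsub>K\<^esub>}"
      by (rule finite_subset[rotated]) auto
    then show "f \<oplus>\<^bsub>K.func_space X\<^esub> g \<in> {f \<in> X \<rightarrow>\<^sub>E carrier K. finite {x \<in> X. f x \<noteq> \<zero>\<^bsub>K\<^esub>}}"
      using f g by (auto simp: K.func_space_def PiE_mem cong: conj_cong)
  next
    fix c f assume c: "c \<in> carrier K"
      and f: "f \<in> {f \<in> X \<rightarrow>\<^sub>E carrier K. finite {x \<in> X. f x \<noteq> \<zero>\<^bsub>K\<^esub>}}"
    have "finite {x \<in> X. f x \<noteq> \<zero>\<^bsub>K\<^esub>}" using f by auto
    then have "finite {x \<in> X. c \<otimes>\<^bsub>K\<^esub> f x \<noteq> \<zero>\<^bsub>K\<^esub>}"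
      by (rule finite_subset[rotated]) (auto simp: c)
    then show "c \<odot>\<^bsub>K.func_space X\<^esub> f \<in> {f \<in> X \<rightarrow>\<^sub>E carrier K. finite {x \<in> X. f x \<noteq> \<zero>\<^bsub>K\<^esub>}}"
      using c f by (auto simp: K.func_space_def PiE_mem cong: conj_cong)
  qed (auto simp: K.func_space_def)
  then show ?thesis unfolding free_space_def by (rule F.subspace_is_vs)
qed

lemma free_gen_closed: "x \<in> X \<Longrightarrow> free_gen K X x \<in> carrier (free_space K X)"
  by (auto simp: free_space_simps free_gen_def)

text \<open>
  Induction on the size of the support: setting the value at one point of the support to zero
  changes a function by a multiple of a generator.
\<close>

lemma span_free_gen: "module.span K (free_space K X) (free_gen K X ` X) = carrier (free_space K X)"
proof (rule span_eq_carrierI[OF vectorspace_free_space])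
  show "free_gen K X ` X \<subseteq> carrier (free_space K X)" using free_gen_closed by auto
next
  fix N assume N: "subspace K N (free_space K X)" and gen: "free_gen K X ` X \<subseteq> N"
  have "f \<in> N" if "finite A" "f \<in> X \<rightarrow>\<^sub>E carrier K" "{x \<in> X. f x \<noteq> \<zero>\<^bsub>K\<^esub>} = A" for f A
    using that
  proof (induction A arbitrary: f)
    case empty
    then have "f = \<zero>\<^bsub>free_space K X\<^esub>"
      by (intro extensionalityI[of _ X]) (auto simp: free_space_simps PiE_def)
    then show ?case using subspaceD(3)[OF N] by simp
  next
    case (insert a A)
    have a: "a \<in> X" "f a \<in> carrier K" using insert by auto
    define g where "g = f(a := \<zero>\<^bsub>K\<^esub>)"
    have "g \<in> N"
    proof (rule insert.IH)
      show "g \<in> X \<rightarrow>\<^sub>E carrier K" using insert a by (auto simp: g_def)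
      show "{x \<in> X. g x \<noteq> \<zero>\<^bsub>K\<^esub>} = A" using insert by (auto simp: g_def)
    qed
    moreover have "f a \<odot>\<^bsub>free_space K X\<^esub> free_gen K X a \<in> N"
      using a gen subspaceD(5)[OF N] by auto
    moreover have "f = g \<oplus>\<^bsub>free_space K X\<^esub> (f a \<odot>\<^bsub>free_space K X\<^esub> free_gen K X a)"
      using insert.prems a by (intro extensionalityI[of _ X]) (auto simp: free_space_simps free_gen_def g_def PiE_def Pi_def)
    ultimately show ?case using subspaceD(4)[OF N] by metis
  qed
  then show "carrier (free_space K X) \<subseteq> N" by (auto simp: free_space_simps)
qed

text \<open>
  The map is \<open>f \<mapsto> \<Sum>\<^sub>x f(x) \<cdot> b(x)\<close> over the support of \<open>f\<close>.  Enlarging the index set to any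
  finite superset of the support leaves the sum unchanged, which makes sums for different
  \<open>f\<close> comparable.
\<close>

lemma free_space_lift:
  assumes U: "vectorspace K U" and b: "b \<in> X \<rightarrow> carrier U"
  obtains h where "linear_map K (free_space K X) U h" "\<And>x. x \<in> X \<Longrightarrow> h (free_gen K X x) = b x"
proof -
  interpret U: vectorspace K U by (rule U)
  define supp where "supp f = {x \<in> X. f x \<noteq> \<zero>\<^bsub>K\<^esub>}" for f :: "'x \<Rightarrow> 'k"
  define h where "h f = (\<Oplus>\<^bsub>U\<^esub>x\<in>supp f. f x \<odot>\<^bsub>U\<^esub> b x)" for f
  have h: "h f = (\<Oplus>\<^bsub>U\<^esub>x\<in>A. f x \<odot>\<^bsub>U\<^esub> b x)"
    if "finite A" "A \<subseteq> X" "supp f \<subseteq> A" "f \<in> X \<rightarrow> carrier K" for f A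
    unfolding h_def using that b
    by (intro U.M.add.finprod_mono_neutral_cong_left) (auto simp: supp_def Pi_def)
  have F: "finite (supp f)" "supp f \<subseteq> X" "f \<in> X \<rightarrow> carrier K" if "f \<in> carrier (free_space K X)" for f
    using that by (auto simp: free_space_simps supp_def)
  show ?thesis
  proof (rule that)
    show "linear_map K (free_space K X) U h"
    proof (rule linear_mapI[OF vectorspace_free_space U])
      fix f assume f: "f \<in> carrier (free_space K X)"
      show "h f \<in> carrier U"
        unfolding h_def using F[OF f] b by (intro U.M.finsum_closed) auto
      fix c assume c: "c \<in> carrier K"
      have "h (c \<odot>\<^bsub>free_space K X\<^esub> f) = (\<Oplus>\<^bsub>U\<^esub>x\<in>supp f. (c \<odot>\<^bsub>free_space K X\<^esub> f) x \<odot>\<^bsub>U\<^esub> b x)"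
        using F[OF f] c by (intro h) (auto simp: supp_def free_space_simps Pi_def)
      also have "\<dots> = (\<Oplus>\<^bsub>U\<^esub>x\<in>supp f. c \<odot>\<^bsub>U\<^esub> (f x \<odot>\<^bsub>U\<^esub> b x))"
        using F[OF f] c b
        by (intro U.M.add.finprod_cong') (auto simp: supp_def free_space_simps Pi_def U.smult_assoc1)
      also have "\<dots> = c \<odot>\<^bsub>U\<^esub> h f"
        unfolding h_def using F[OF f] c b by (intro U.finsum_smult[symmetric]) (auto simp: supp_def Pi_def)
      finally show "h (c \<odot>\<^bsub>free_space K X\<^esub> f) = c \<odot>\<^bsub>U\<^esub> h f" .
    next
      fix f g assume f: "f \<in> carrier (free_space K X)" and g: "g \<in> carrier (free_space K X)"
      let ?A = "supp f \<union> supp g"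
      have A: "finite ?A" "?A \<subseteq> X" using F[OF f] F[OF g] by auto
      have "h (f \<oplus>\<^bsub>free_space K X\<^esub> g) = (\<Oplus>\<^bsub>U\<^esub>x\<in>?A. (f \<oplus>\<^bsub>free_space K X\<^esub> g) x \<odot>\<^bsub>U\<^esub> b x)"
        using F(3)[OF f] F(3)[OF g] A by (intro h) (auto simp: supp_def free_space_simps Pi_def)
      also have "\<dots> = (\<Oplus>\<^bsub>U\<^esub>x\<in>?A. f x \<odot>\<^bsub>U\<^esub> b x \<oplus>\<^bsub>U\<^esub> g x \<odot>\<^bsub>U\<^esub> b x)"
        using F(3)[OF f] F(3)[OF g] b A
        by (intro U.M.add.finprod_cong') (auto simp: supp_def free_space_simps Pi_def U.smult_l_distr)
      also have "\<dots> = (\<Oplus>\<^bsub>U\<^esub>x\<in>?A. f x \<odot>\<^bsub>U\<^esub> b x) \<oplus>\<^bsub>U\<^esub> (\<Oplus>\<^bsub>U\<^esub>x\<in>?A. g x \<odot>\<^bsub>U\<^esub> b x)"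
        using F(3)[OF f] F(3)[OF g] b A by (intro U.M.finsum_addf) (auto simp: supp_def)
      also have "(\<Oplus>\<^bsub>U\<^esub>x\<in>?A. f x \<odot>\<^bsub>U\<^esub> b x) = h f"
        using F(3)[OF f] A by (intro h[symmetric]) auto
      also have "(\<Oplus>\<^bsub>U\<^esub>x\<in>?A. g x \<odot>\<^bsub>U\<^esub> b x) = h g"
        using F(3)[OF g] A by (intro h[symmetric]) auto
      finally show "h (f \<oplus>\<^bsub>free_space K X\<^esub> g) = h f \<oplus>\<^bsub>U\<^esub> h g" .
    qed
  next
    fix x assume x: "x \<in> X"
    have "h (free_gen K X x) = (\<Oplus>\<^bsub>U\<^esub>y\<in>{x}. free_gen K X x y \<odot>\<^bsub>U\<^esub> b y)"
      using x by (intro h) (auto simp: supp_def free_gen_def)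
    also have "\<dots> = b x"
      using x b by (simp add: free_gen_def Pi_def)
    finally show "h (free_gen K X x) = b x" .
  qed
qed

end

section \<open>Quotient spaces\<close>

context
  fixes K :: "'k ring" and V :: "('k, 'v) module" and N :: "'v set"
  assumes N: "subspace K N V"
begin

interpretation V: vectorspace K V by (rule subspaceD(1)[OF N])

text \<open>
  A subspace is only required to contain zero and to be closed under addition and scalars;
  negation is multiplication by \<open>-1\<close>.
\<close>

lemma abelian_subgroup_subspace: "abelian_subgroup N V"
proof (rule abelian_subgroupI3)
  have inv: "\<ominus>\<^bsub>V\<^esub> v \<in> N" if "v \<in> N" for v
    using subspaceD(5)[OF N _ that, of "\<ominus>\<^bsub>K\<^esub> \<one>\<^bsub>K\<^esub>"] subspaceD(2)[OF N] that
    by (auto simp: V.smult_minus_1)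
  show "additive_subgroup N V"
    using subspaceD[OF N] inv
    by (intro additive_subgroupI V.M.add.subgroupI) (auto simp flip: a_inv_def)
qed (rule V.M.abelian_group_axioms)

interpretation N: abelian_subgroup N V by (rule abelian_subgroup_subspace)

lemma coset_eq_iff:
  assumes "v \<in> carrier V" "w \<in> carrier V"
  shows "N +>\<^bsub>V\<^esub> v = N +>\<^bsub>V\<^esub> w \<longleftrightarrow> v \<ominus>\<^bsub>V\<^esub> w \<in> N"
proof
  assume "N +>\<^bsub>V\<^esub> v = N +>\<^bsub>V\<^esub> w"
  then have "v \<in> N +>\<^bsub>V\<^esub> w" using N.a_rcos_self[OF assms(1)] by simp
  then show "v \<ominus>\<^bsub>V\<^esub> w \<in> N"
    using N.a_rcos_module_imp[OF assms(2)] by (simp add: a_minus_def)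
next
  assume "v \<ominus>\<^bsub>V\<^esub> w \<in> N"
  then have "v \<in> N +>\<^bsub>V\<^esub> w"
    using N.a_rcos_module_rev[OF assms(2,1)] by (simp add: a_minus_def)
  then show "N +>\<^bsub>V\<^esub> v = N +>\<^bsub>V\<^esub> w"
    using N.a_repr_independence'[OF _ assms(2)] by simp
qed

lemma quotient_space_simps:
  shows "carrier (quotient_space V N) = (\<lambda>v. N +>\<^bsub>V\<^esub> v) ` carrier V"
    and "\<zero>\<^bsub>quotient_space V N\<^esub> = N +>\<^bsub>V\<^esub> \<zero>\<^bsub>V\<^esub>"
    and "\<lbrakk>v \<in> carrier V; w \<in> carrier V\<rbrakk> \<Longrightarrow>
      (N +>\<^bsub>V\<^esub> v) \<oplus>\<^bsub>quotient_space V N\<^esub> (N +>\<^bsub>V\<^esub> w) = N +>\<^bsub>V\<^esub> (v \<oplus>\<^bsub>V\<^esub> w)"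
    and "\<lbrakk>c \<in> carrier K; v \<in> carrier V\<rbrakk> \<Longrightarrow>
      c \<odot>\<^bsub>quotient_space V N\<^esub> (N +>\<^bsub>V\<^esub> v) = N +>\<^bsub>V\<^esub> (c \<odot>\<^bsub>V\<^esub> v)"
proof -
  show "carrier (quotient_space V N) = (\<lambda>v. N +>\<^bsub>V\<^esub> v) ` carrier V"
    by (auto simp: quotient_space_def A_RCOSETS_def')
  show "\<zero>\<^bsub>quotient_space V N\<^esub> = N +>\<^bsub>V\<^esub> \<zero>\<^bsub>V\<^esub>"
    using subspaceD(2)[OF N] by (simp add: quotient_space_def)
  show "(N +>\<^bsub>V\<^esub> v) \<oplus>\<^bsub>quotient_space V N\<^esub> (N +>\<^bsub>V\<^esub> w) = N +>\<^bsub>V\<^esub> (v \<oplus>\<^bsub>V\<^esub> w)"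
    if "v \<in> carrier V" "w \<in> carrier V"
    using that by (simp add: quotient_space_def N.a_rcos_sum)
  show "c \<odot>\<^bsub>quotient_space V N\<^esub> (N +>\<^bsub>V\<^esub> v) = N +>\<^bsub>V\<^esub> (c \<odot>\<^bsub>V\<^esub> v)"
    if c: "c \<in> carrier K" and v: "v \<in> carrier V"
  proof -
    have "N +>\<^bsub>V\<^esub> (c \<odot>\<^bsub>V\<^esub> a) = N +>\<^bsub>V\<^esub> (c \<odot>\<^bsub>V\<^esub> v)" if a: "a \<in> N +>\<^bsub>V\<^esub> v" for a
    proof -
      have a_carrier: "a \<in> carrier V"
        using N.a_elemrcos_carrier[OF v a] .
      have "N +>\<^bsub>V\<^esub> a = N +>\<^bsub>V\<^esub> v"
        using N.a_repr_independence'[OF a v] by simp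
      then have "a \<ominus>\<^bsub>V\<^esub> v \<in> N"
        using coset_eq_iff[OF a_carrier v] by simp
      then have "c \<odot>\<^bsub>V\<^esub> (a \<ominus>\<^bsub>V\<^esub> v) \<in> N"
        using subspaceD(5)[OF N] c by blast
      also have "c \<odot>\<^bsub>V\<^esub> (a \<ominus>\<^bsub>V\<^esub> v) = c \<odot>\<^bsub>V\<^esub> a \<ominus>\<^bsub>V\<^esub> c \<odot>\<^bsub>V\<^esub> v"
        unfolding a_minus_def using c v a_carrier
        by (subst V.smult_r_distr) (auto simp: V.smult_r_minus)
      finally show ?thesis
        using c v a_carrier by (subst coset_eq_iff) auto
    qed
    moreover have "v \<in> N +>\<^bsub>V\<^esub> v" using N.a_rcos_self v by simp
    ultimately have "(\<Union>a\<in>N +>\<^bsub>V\<^esub> v. N +>\<^bsub>V\<^esub> (c \<odot>\<^bsub>V\<^esub> a)) = N +>\<^bsub>V\<^esub> (c \<odot>\<^bsub>V\<^esub> v)"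
      by blast
    then show ?thesis by (simp add: quotient_space_def)
  qed
qed

lemma vectorspace_quotient_space: "vectorspace K (quotient_space V N)"
proof (rule vs_criteria)
  show "field K" by unfold_locales
  show "\<forall>C\<in>carrier (quotient_space V N). \<exists>D\<in>carrier (quotient_space V N).
      C \<oplus>\<^bsub>quotient_space V N\<^esub> D = \<zero>\<^bsub>quotient_space V N\<^esub>"
  proof
    fix C assume "C \<in> carrier (quotient_space V N)"
    then obtain v where v: "v \<in> carrier V" "C = N +>\<^bsub>V\<^esub> v"
      by (auto simp: quotient_space_simps)
    then have "C \<oplus>\<^bsub>quotient_space V N\<^esub> (N +>\<^bsub>V\<^esub> (\<ominus>\<^bsub>V\<^esub> v)) = \<zero>\<^bsub>quotient_space V N\<^esub>"
      by (simp only: quotient_space_simps V.M.a_inv_closed V.M.r_neg)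
    moreover have "N +>\<^bsub>V\<^esub> (\<ominus>\<^bsub>V\<^esub> v) \<in> carrier (quotient_space V N)"
      using v by (simp add: quotient_space_simps)
    ultimately show "\<exists>D\<in>carrier (quotient_space V N).
        C \<oplus>\<^bsub>quotient_space V N\<^esub> D = \<zero>\<^bsub>quotient_space V N\<^esub>" by blast
  qed
  \<comment> \<open>The remaining axioms, in groups: closure; commutativity; associativity; zero; scalars.  Each is
    inherited from \<open>V\<close> along the surjection onto the cosets.\<close>
qed (unfold quotient_space_simps(1),
    (auto simp: quotient_space_simps(2-))[3],
    (auto simp: quotient_space_simps(3-) V.M.a_comm)[1],
    (auto simp: quotient_space_simps(3-) V.M.a_assoc)[1],
    (auto simp: quotient_space_simps(2-) simp del: V.M.a_coset_add_zero)[1],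
    auto simp: quotient_space_simps(3-) V.smult_assoc1 V.smult_l_distr V.smult_r_distr)

lemma linear_map_quotient: "linear_map K V (quotient_space V N) (\<lambda>v. N +>\<^bsub>V\<^esub> v)"
  by (rule linear_mapI[OF V.vectorspace_axioms vectorspace_quotient_space]) (auto simp: quotient_space_simps)

text \<open>
  The value on a coset is read off at any representative; the choice does not matter because
  representatives differ by an element of \<open>N\<close>.
\<close>

lemma quotient_space_factor:
  assumes h: "linear_map K V U h" and null: "\<And>v. v \<in> N \<Longrightarrow> h v = \<zero>\<^bsub>U\<^esub>"
  obtains h' where "linear_map K (quotient_space V N) U h'"
    "\<And>v. v \<in> carrier V \<Longrightarrow> h' (N +>\<^bsub>V\<^esub> v) = h v"
proof -
  interpret h: linear_map K V U h by fact
  define h' where "h' C = h (SOME v. v \<in> carrier V \<and> C = N +>\<^bsub>V\<^esub> v)" for C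
  have h': "h' (N +>\<^bsub>V\<^esub> v) = h v" if v: "v \<in> carrier V" for v
  proof -
    define w where "w = (SOME w. w \<in> carrier V \<and> N +>\<^bsub>V\<^esub> v = N +>\<^bsub>V\<^esub> w)"
    have w: "w \<in> carrier V" "N +>\<^bsub>V\<^esub> v = N +>\<^bsub>V\<^esub> w"
      using someI[of "\<lambda>w. w \<in> carrier V \<and> N +>\<^bsub>V\<^esub> v = N +>\<^bsub>V\<^esub> w" v] v by (auto simp: w_def)
    then have "h (v \<ominus>\<^bsub>V\<^esub> w) = \<zero>\<^bsub>U\<^esub>" using coset_eq_iff[OF v w(1)] null by simp
    then have "h v = h w" using v w by (simp add: h.f_minus)
    then show ?thesis by (simp add: h'_def w_def)
  qed
  show ?thesis
  proof (rule that)
    show "linear_map K (quotient_space V N) U h'"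
      by (rule linear_mapI[OF vectorspace_quotient_space])
        (auto simp: quotient_space_simps h' linear_mapD[OF h] h.W.vectorspace_axioms)
  qed (rule h')
qed

end

section \<open>Tensor products by generators and relations\<close>

definition bilinear_map ::
    "'k ring \<Rightarrow> ('k, 'v) module \<Rightarrow> ('k, 'w) module \<Rightarrow> ('k, 'u) module \<Rightarrow> ('v \<Rightarrow> 'w \<Rightarrow> 'u) \<Rightarrow> bool" where
  "bilinear_map K V W U b \<longleftrightarrow>
     (\<forall>v\<in>carrier V. linear_map K W U (b v)) \<and> (\<forall>w\<in>carrier W. linear_map K V U (\<lambda>v. b v w))"

lemma bilinear_map_comp:
  assumes "bilinear_map K V W U b" "linear_map K V' V f" "linear_map K W' W g" "linear_map K U U' h"
  shows "bilinear_map K V' W' U' (\<lambda>v w. h (b (f v) (g w)))"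
  unfolding bilinear_map_def
proof (intro conjI ballI)
  fix v assume "v \<in> carrier V'"
  then have "linear_map K W U (b (f v))"
    using assms(1) linear_mapD(3)[OF assms(2)] by (simp add: bilinear_map_def)
  from linear_map_comp[OF linear_map_comp[OF assms(3) this] assms(4)]
  show "linear_map K W' U' (\<lambda>w. h (b (f v) (g w)))" by (simp add: o_def)
next
  fix w assume "w \<in> carrier W'"
  then have "linear_map K V U (\<lambda>v. b v (g w))"
    using assms(1) linear_mapD(3)[OF assms(3)] by (simp add: bilinear_map_def)
  from linear_map_comp[OF linear_map_comp[OF assms(2) this] assms(4)]
  show "linear_map K V' U' (\<lambda>v. h (b (f v) (g w)))" by (simp add: o_def)
qed

lemma bilinear_map_flip: "bilinear_map K V W U b \<Longrightarrow> bilinear_map K W V U (\<lambda>w v. b v w)"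
  by (simp add: bilinear_map_def)

text \<open>
  Linear maps out of tensor products are given by definite descriptions of this form.  If \<open>Q\<close> and \<open>R\<close> depend
  only on the values on \<open>X\<close> and determine them, then the description is proper, because a map that
  satisfies them can be restricted to \<open>X\<close>.
\<close>

lemma the_extensional:
  assumes cong: "\<And>g. (\<And>x. x \<in> X \<Longrightarrow> g x = h x) \<Longrightarrow> Q g \<and> R g"
    and unique: "\<And>g x. \<lbrakk>Q g; R g; x \<in> X\<rbrakk> \<Longrightarrow> g x = h x"
  shows "Q (THE h. Q h \<and> h \<in> extensional X \<and> R h) \<and> R (THE h. Q h \<and> h \<in> extensional X \<and> R h)"
proof -
  have "Q (restrict h X) \<and> restrict h X \<in> extensional X \<and> R (restrict h X)"
    using cong[of "restrict h X"] by simp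
  moreover have "g = restrict h X" if "Q g \<and> g \<in> extensional X \<and> R g" for g
    using that unique by (intro extensionalityI[of _ X]) auto
  ultimately have "Q H \<and> H \<in> extensional X \<and> R H" if "H = (THE h. Q h \<and> h \<in> extensional X \<and> R h)" for H
    unfolding that by (rule theI)
  then show ?thesis by blast
qed

context
  fixes K :: "'k ring" and V :: "('k, 'v) module" and W :: "('k, 'w) module"
  assumes V: "vectorspace K V" and W: "vectorspace K W"
begin

interpretation V: vectorspace K V by (rule V)
interpretation W: vectorspace K W by (rule W)

private abbreviation (input) "F \<equiv> free_space K (carrier V \<times> carrier W)"
private abbreviation (input) "\<delta> \<equiv> free_gen K (carrier V \<times> carrier W)"
private abbreviation (input) "N \<equiv> tensor_null K V W"
private abbreviation (input) "T \<equiv> tensor_space K V W"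
private abbreviation (input) pure (infixl \<open>\<otimes>\<^sub>T\<close> 75) where "v \<otimes>\<^sub>T w \<equiv> pure_tensor K V W v w"

interpretation F: vectorspace K F
  by (rule vectorspace_free_space) unfold_locales

lemma tensor_field: "field K" by unfold_locales

lemma tensor_gen_closed: "\<lbrakk>v \<in> carrier V; w \<in> carrier W\<rbrakk> \<Longrightarrow> \<delta> (v, w) \<in> carrier F"
  by (rule free_gen_closed[OF tensor_field]) auto

lemma tensor_relations_closed: "tensor_relations K V W \<subseteq> carrier F"
  by (auto simp: tensor_relations_def Let_def tensor_gen_closed intro!: F.M.minus_closed F.M.a_closed F.smult_closed)

lemma tensor_relations_memI:
  shows "\<lbrakk>v \<in> carrier V; v' \<in> carrier V; w \<in> carrier W\<rbrakk> \<Longrightarrow>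
      \<delta> (v \<oplus>\<^bsub>V\<^esub> v', w) \<ominus>\<^bsub>F\<^esub> (\<delta> (v, w) \<oplus>\<^bsub>F\<^esub> \<delta> (v', w)) \<in> tensor_relations K V W"
    and "\<lbrakk>v \<in> carrier V; w \<in> carrier W; w' \<in> carrier W\<rbrakk> \<Longrightarrow>
      \<delta> (v, w \<oplus>\<^bsub>W\<^esub> w') \<ominus>\<^bsub>F\<^esub> (\<delta> (v, w) \<oplus>\<^bsub>F\<^esub> \<delta> (v, w')) \<in> tensor_relations K V W"
    and "\<lbrakk>c \<in> carrier K; v \<in> carrier V; w \<in> carrier W\<rbrakk> \<Longrightarrow>
      \<delta> (c \<odot>\<^bsub>V\<^esub> v, w) \<ominus>\<^bsub>F\<^esub> (c \<odot>\<^bsub>F\<^esub> \<delta> (v, w)) \<in> tensor_relations K V W"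
    and "\<lbrakk>c \<in> carrier K; v \<in> carrier V; w \<in> carrier W\<rbrakk> \<Longrightarrow>
      \<delta> (v, c \<odot>\<^bsub>W\<^esub> w) \<ominus>\<^bsub>F\<^esub> (c \<odot>\<^bsub>F\<^esub> \<delta> (v, w)) \<in> tensor_relations K V W"
  unfolding tensor_relations_def Let_def
  subgoal by (rule UnI1, rule UnI1, rule UnI1, rule CollectI, intro exI conjI, rule refl, assumption+)
  subgoal by (rule UnI1, rule UnI1, rule UnI2, rule CollectI, intro exI conjI, rule refl, assumption+)
  subgoal by (rule UnI1, rule UnI2, rule CollectI, intro exI conjI, rule refl, assumption+)
  subgoal by (rule UnI2, rule CollectI, intro exI conjI, rule refl, assumption+)
  done

lemma subspace_tensor_null: "subspace K N F"
  unfolding tensor_null_def by (rule F.span_is_subspace[OF tensor_relations_closed])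

lemma vectorspace_tensor_space: "vectorspace K T"
  unfolding tensor_space_def by (rule vectorspace_quotient_space[OF subspace_tensor_null])

lemma linear_map_tensor_quotient: "linear_map K F T (\<lambda>f. N +>\<^bsub>F\<^esub> f)"
  unfolding tensor_space_def by (rule linear_map_quotient[OF subspace_tensor_null])

lemma coset_eq_if_tensor_relation:
  assumes "f \<ominus>\<^bsub>F\<^esub> g \<in> tensor_relations K V W" "f \<in> carrier F" "g \<in> carrier F"
  shows "N +>\<^bsub>F\<^esub> f = N +>\<^bsub>F\<^esub> g"
  using assms F.in_own_span[OF tensor_relations_closed]
  by (subst coset_eq_iff[OF subspace_tensor_null]) (auto simp: tensor_null_def)

lemma bilinear_map_pure_tensor: "bilinear_map K V W T (\<otimes>\<^sub>T)"
proof -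
  note q = linear_mapD[OF linear_map_tensor_quotient]
  note closed = tensor_gen_closed F.M.a_closed F.smult_closed V.M.a_closed W.M.a_closed
    V.smult_closed W.smult_closed
  show ?thesis
    unfolding bilinear_map_def
  proof (intro conjI ballI linear_mapI V W vectorspace_tensor_space)
    fix v w w' assume *: "v \<in> carrier V" "w \<in> carrier W" "w' \<in> carrier W"
    have "N +>\<^bsub>F\<^esub> \<delta> (v, w \<oplus>\<^bsub>W\<^esub> w') = N +>\<^bsub>F\<^esub> (\<delta> (v, w) \<oplus>\<^bsub>F\<^esub> \<delta> (v, w'))"
      using * by (intro coset_eq_if_tensor_relation closed tensor_relations_memI)
    then show "v \<otimes>\<^sub>T (w \<oplus>\<^bsub>W\<^esub> w') = v \<otimes>\<^sub>T w \<oplus>\<^bsub>T\<^esub> v \<otimes>\<^sub>T w'"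
      using * by (simp add: pure_tensor_def q tensor_gen_closed)
  next
    fix v c w assume *: "v \<in> carrier V" "c \<in> carrier K" "w \<in> carrier W"
    have "N +>\<^bsub>F\<^esub> \<delta> (v, c \<odot>\<^bsub>W\<^esub> w) = N +>\<^bsub>F\<^esub> (c \<odot>\<^bsub>F\<^esub> \<delta> (v, w))"
      using * by (intro coset_eq_if_tensor_relation closed tensor_relations_memI)
    then show "v \<otimes>\<^sub>T (c \<odot>\<^bsub>W\<^esub> w) = c \<odot>\<^bsub>T\<^esub> v \<otimes>\<^sub>T w"
      using * by (simp add: pure_tensor_def q tensor_gen_closed)
  next
    fix w v v' assume *: "w \<in> carrier W" "v \<in> carrier V" "v' \<in> carrier V"
    have "N +>\<^bsub>F\<^esub> \<delta> (v \<oplus>\<^bsub>V\<^esub> v', w) = N +>\<^bsub>F\<^esub> (\<delta> (v, w) \<oplus>\<^bsub>F\<^esub> \<delta> (v', w))"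
      using * by (intro coset_eq_if_tensor_relation closed tensor_relations_memI)
    then show "(v \<oplus>\<^bsub>V\<^esub> v') \<otimes>\<^sub>T w = v \<otimes>\<^sub>T w \<oplus>\<^bsub>T\<^esub> v' \<otimes>\<^sub>T w"
      using * by (simp add: pure_tensor_def q tensor_gen_closed)
  next
    fix w c v assume *: "w \<in> carrier W" "c \<in> carrier K" "v \<in> carrier V"
    have "N +>\<^bsub>F\<^esub> \<delta> (c \<odot>\<^bsub>V\<^esub> v, w) = N +>\<^bsub>F\<^esub> (c \<odot>\<^bsub>F\<^esub> \<delta> (v, w))"
      using * by (intro coset_eq_if_tensor_relation closed tensor_relations_memI)
    then show "(c \<odot>\<^bsub>V\<^esub> v) \<otimes>\<^sub>T w = c \<odot>\<^bsub>T\<^esub> v \<otimes>\<^sub>T w"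
      using * by (simp add: pure_tensor_def q tensor_gen_closed)
  qed (simp_all add: pure_tensor_def q tensor_gen_closed)
qed

lemma linear_map_pure_tensor:
  shows "v \<in> carrier V \<Longrightarrow> linear_map K W T (\<lambda>w. v \<otimes>\<^sub>T w)"
    and "w \<in> carrier W \<Longrightarrow> linear_map K V T (\<lambda>v. v \<otimes>\<^sub>T w)"
  using bilinear_map_pure_tensor by (auto simp: bilinear_map_def)

lemma pure_tensor_closed: "\<lbrakk>v \<in> carrier V; w \<in> carrier W\<rbrakk> \<Longrightarrow> v \<otimes>\<^sub>T w \<in> carrier T"
  using linear_mapD(3)[OF linear_map_pure_tensor(1)] .

text \<open>
  For a subspace \<open>P\<close> of \<open>V \<otimes> W\<close> that contains all \<open>a \<otimes> b\<close>, the preimage of \<open>P\<close> under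
  \<open>v \<mapsto> v \<otimes> b\<close> is a subspace containing \<open>A\<close>, hence everything; then the same argument in the second
  factor.  So \<open>P\<close> contains every pure tensor, and these are the images of the generators of the
  free space.
\<close>

lemma span_pure_tensors:
  assumes A: "A \<subseteq> carrier V" "module.span K V A = carrier V"
    and B: "B \<subseteq> carrier W" "module.span K W B = carrier W"
  shows "module.span K T {a \<otimes>\<^sub>T b | a b. a \<in> A \<and> b \<in> B} = carrier T"
proof (rule span_eq_carrierI[OF vectorspace_tensor_space])
  show "{a \<otimes>\<^sub>T b | a b. a \<in> A \<and> b \<in> B} \<subseteq> carrier T"
    using A(1) B(1) by (blast intro: pure_tensor_closed)
next
  fix P assume P: "subspace K P T" and AB: "{a \<otimes>\<^sub>T b | a b. a \<in> A \<and> b \<in> B} \<subseteq> P"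
  have vb: "v \<otimes>\<^sub>T b \<in> P" if v: "v \<in> carrier V" and b: "b \<in> B" for v b
  proof -
    have "subspace K {v \<in> carrier V. v \<otimes>\<^sub>T b \<in> P} V"
      using b B(1) by (intro subspace_preimage[OF linear_map_pure_tensor(2) P]) auto
    moreover have "A \<subseteq> {v \<in> carrier V. v \<otimes>\<^sub>T b \<in> P}" using A(1) AB b by blast
    ultimately show ?thesis using span_subset_subspace A(2) v by blast
  qed
  have vw: "v \<otimes>\<^sub>T w \<in> P" if v: "v \<in> carrier V" and w: "w \<in> carrier W" for v w
  proof -
    have "subspace K {w \<in> carrier W. v \<otimes>\<^sub>T w \<in> P} W"
      using v by (rule subspace_preimage[OF linear_map_pure_tensor(1) P])
    moreover have "B \<subseteq> {w \<in> carrier W. v \<otimes>\<^sub>T w \<in> P}" using B(1) vb v by blast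
    ultimately show ?thesis using span_subset_subspace B(2) w by blast
  qed
  have "module.span K F (\<delta> ` (carrier V \<times> carrier W)) \<subseteq> {f \<in> carrier F. N +>\<^bsub>F\<^esub> f \<in> P}"
    using vw tensor_gen_closed
    by (intro span_subset_subspace subspace_preimage[OF linear_map_tensor_quotient P])
      (auto simp: pure_tensor_def)
  then have "N +>\<^bsub>F\<^esub> f \<in> P" if "f \<in> carrier F" for f
    using that span_free_gen[OF tensor_field] by auto
  then show "carrier T \<subseteq> P"
    by (auto simp: tensor_space_def quotient_space_simps(1)[OF subspace_tensor_null])
qed

lemma linear_map_eq_on_tensors:
  assumes "linear_map K T U f" "linear_map K T U g"
    and "\<And>v w. \<lbrakk>v \<in> carrier V; w \<in> carrier W\<rbrakk> \<Longrightarrow> f (v \<otimes>\<^sub>T w) = g (v \<otimes>\<^sub>T w)"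
    and "x \<in> carrier T"
  shows "f x = g x"
proof (rule linear_map_eq_on_span[OF assms(1,2)])
  let ?A = "{v \<otimes>\<^sub>T w | v w. v \<in> carrier V \<and> w \<in> carrier W}"
  have "module.span K V (carrier V) = carrier V" "module.span K W (carrier W) = carrier W"
    by (rule span_eq_carrierI; use V W in blast)+
  then show "x \<in> module.span K T ?A" using span_pure_tensors assms(4) by simp
  show "?A \<subseteq> carrier T" using pure_tensor_closed by auto
qed (use assms(3) in auto)

text \<open>
  Extend \<open>b\<close> to the free space on the pairs.  Bilinearity says exactly that this extension kills the
  defining relations of the tensor product.
\<close>

lemma tensor_lift_exists:
  assumes b: "bilinear_map K V W U b" and U: "vectorspace K U"
  shows "\<exists>h. linear_map K T U h \<and> (\<forall>v\<in>carrier V. \<forall>w\<in>carrier W. h (v \<otimes>\<^sub>T w) = b v w)"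
proof -
  interpret U: vectorspace K U by (rule U)
  have b1: "linear_map K W U (b v)" if "v \<in> carrier V" for v
    using b that by (simp add: bilinear_map_def)
  have b2: "linear_map K V U (\<lambda>v. b v w)" if "w \<in> carrier W" for w
    using b that by (simp add: bilinear_map_def)
  have closed: "b v w \<in> carrier U" if "v \<in> carrier V" "w \<in> carrier W" for v w
    using linear_mapD(3)[OF b1] that .
  obtain h where h: "linear_map K F U h" "\<And>x. x \<in> carrier V \<times> carrier W \<Longrightarrow> h (\<delta> x) = case_prod b x"
    using free_space_lift[OF tensor_field U, of "case_prod b" "carrier V \<times> carrier W"] closed
    by (metis (no_types, lifting) Pi_I SigmaE case_prod_conv)
  interpret h: linear_map K F U h by (rule h(1))
  have hD: "h (\<delta> (v, w)) = b v w" if "v \<in> carrier V" "w \<in> carrier W" for v w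
    using h(2)[of "(v, w)"] that by simp
  have "tensor_relations K V W \<subseteq> {f \<in> carrier F. h f = \<zero>\<^bsub>U\<^esub>}"
  proof
    fix f assume f: "f \<in> tensor_relations K V W"
    then have "h f = \<zero>\<^bsub>U\<^esub>"
      unfolding tensor_relations_def Let_def
      by (auto simp: h.f_minus tensor_gen_closed hD closed linear_mapD[OF b1] linear_mapD[OF b2])
    then show "f \<in> {f \<in> carrier F. h f = \<zero>\<^bsub>U\<^esub>}" using f tensor_relations_closed by auto
  qed
  moreover have "subspace K {f \<in> carrier F. h f = \<zero>\<^bsub>U\<^esub>} F"
    using h.kerT_is_subspace by (simp add: h.ker_def)
  ultimately have null: "h f = \<zero>\<^bsub>U\<^esub>" if "f \<in> N" for f
    using span_subset_subspace that unfolding tensor_null_def by blast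
  obtain h' where "linear_map K T U h'" "\<And>f. f \<in> carrier F \<Longrightarrow> h' (N +>\<^bsub>F\<^esub> f) = h f"
    using quotient_space_factor[OF subspace_tensor_null h(1) null] unfolding tensor_space_def by blast
  then show ?thesis using hD tensor_gen_closed by (auto simp: pure_tensor_def)
qed

lemma tensor_lift:
  assumes b: "bilinear_map K V W U b" and U: "vectorspace K U"
  shows "linear_map K T U (tensor_lift K V W U b)"
    and "\<lbrakk>v \<in> carrier V; w \<in> carrier W\<rbrakk> \<Longrightarrow> tensor_lift K V W U b (v \<otimes>\<^sub>T w) = b v w"
proof -
  obtain h where h: "linear_map K T U h"
    "\<And>v w. \<lbrakk>v \<in> carrier V; w \<in> carrier W\<rbrakk> \<Longrightarrow> h (v \<otimes>\<^sub>T w) = b v w"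
    using tensor_lift_exists[OF b U] by blast
  have "linear_map K T U (tensor_lift K V W U b) \<and>
    (\<forall>v\<in>carrier V. \<forall>w\<in>carrier W. tensor_lift K V W U b (v \<otimes>\<^sub>T w) = b v w)"
    unfolding tensor_lift_def
  proof (rule the_extensional[where h = h])
    fix g assume "\<And>x. x \<in> carrier T \<Longrightarrow> g x = h x"
    then show "linear_map K T U g \<and> (\<forall>v\<in>carrier V. \<forall>w\<in>carrier W. g (v \<otimes>\<^sub>T w) = b v w)"
      using h pure_tensor_closed linear_map_cong[OF h(1)] by auto
  qed (use linear_map_eq_on_tensors[OF _ h(1)] h(2) in auto)
  then show "linear_map K T U (tensor_lift K V W U b)"
    "\<lbrakk>v \<in> carrier V; w \<in> carrier W\<rbrakk> \<Longrightarrow> tensor_lift K V W U b (v \<otimes>\<^sub>T w) = b v w"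
    by auto
qed

end

section \<open>Functoriality and associativity of the tensor product\<close>

lemma tensor_map:
  assumes f: "linear_map K V V' f" and g: "linear_map K W W' g"
  shows "linear_map K (tensor_space K V W) (tensor_space K V' W') (tensor_map K V W V' W' f g)"
    and "\<lbrakk>v \<in> carrier V; w \<in> carrier W\<rbrakk> \<Longrightarrow>
      tensor_map K V W V' W' f g (pure_tensor K V W v w) = pure_tensor K V' W' (f v) (g w)"
proof -
  note vs = linear_mapD(1)[OF f] linear_mapD(1)[OF g]
  note vs' = linear_mapD(2)[OF f] linear_mapD(2)[OF g]
  have T': "vectorspace K (tensor_space K V' W')" by (rule vectorspace_tensor_space[OF vs'])
  have b: "bilinear_map K V W (tensor_space K V' W') (\<lambda>v w. pure_tensor K V' W' (f v) (g w))"
    using bilinear_map_comp[OF bilinear_map_pure_tensor[OF vs'] f g linear_map_id[OF T']] by simp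
  show "linear_map K (tensor_space K V W) (tensor_space K V' W') (tensor_map K V W V' W' f g)"
    "\<lbrakk>v \<in> carrier V; w \<in> carrier W\<rbrakk> \<Longrightarrow>
      tensor_map K V W V' W' f g (pure_tensor K V W v w) = pure_tensor K V' W' (f v) (g w)"
    unfolding tensor_map_def using tensor_lift[OF vs b T'] by auto
qed

text \<open>
  A trilinear map, lifted in two of its variables, stays linear in the third: by uniqueness of the
  lift, sums and scalar multiples in \<open>w\<close> can be compared on pure tensors.  This provides the
  associativity isomorphisms.
\<close>

lemma bilinear_map_tensor_lift:
  assumes U: "vectorspace K U" and V: "vectorspace K V" and W: "vectorspace K W" and X: "vectorspace K X"
    and b: "\<And>w. w \<in> carrier W \<Longrightarrow> bilinear_map K U V X (b w)"
    and lin: "\<And>u v. \<lbrakk>u \<in> carrier U; v \<in> carrier V\<rbrakk> \<Longrightarrow> linear_map K W X (\<lambda>w. b w u v)"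
  shows "bilinear_map K (tensor_space K U V) W X (\<lambda>x w. tensor_lift K U V X (b w) x)"
proof -
  interpret W: vectorspace K W by (rule W)
  note L = tensor_lift[OF U V b X]
  show ?thesis
    unfolding bilinear_map_def
  proof (intro conjI ballI linear_mapI[OF W X])
    fix x w w' assume x: "x \<in> carrier (tensor_space K U V)" and w: "w \<in> carrier W" "w' \<in> carrier W"
    show "tensor_lift K U V X (b (w \<oplus>\<^bsub>W\<^esub> w')) x =
        tensor_lift K U V X (b w) x \<oplus>\<^bsub>X\<^esub> tensor_lift K U V X (b w') x"
      using w by (intro linear_map_eq_on_tensors[OF U V L(1) linear_map_add[OF L(1) L(1)] _ x])
        (auto simp: L(2) linear_mapD(4)[OF lin])
  next
    fix x c w assume x: "x \<in> carrier (tensor_space K U V)" and w: "c \<in> carrier K" "w \<in> carrier W"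
    show "tensor_lift K U V X (b (c \<odot>\<^bsub>W\<^esub> w)) x = c \<odot>\<^bsub>X\<^esub> tensor_lift K U V X (b w) x"
      using w by (intro linear_map_eq_on_tensors[OF U V L(1) linear_map_smult[OF L(1)] _ x])
        (auto simp: L(2) linear_mapD(5)[OF lin])
  qed (use L(1) linear_mapD(3)[OF L(1)] in auto)
qed

context
  fixes K :: "'k ring" and U :: "('k, 'u) module" and V :: "('k, 'v) module" and W :: "('k, 'w) module"
  assumes U: "vectorspace K U" and V: "vectorspace K V" and W: "vectorspace K W"
begin

private abbreviation (input) "UV \<equiv> tensor_space K U V"
private abbreviation (input) "VW \<equiv> tensor_space K V W"
private abbreviation (input) "UV_W \<equiv> tensor_space K UV W"
private abbreviation (input) "U_VW \<equiv> tensor_space K U VW"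
private abbreviation (input) "left u v w \<equiv> pure_tensor K UV W (pure_tensor K U V u v) w"
private abbreviation (input) "right u v w \<equiv> pure_tensor K U VW u (pure_tensor K V W v w)"

lemma vectorspace_triple_tensors: "vectorspace K UV" "vectorspace K VW" "vectorspace K UV_W" "vectorspace K U_VW"
  by (rule vectorspace_tensor_space[OF U V] vectorspace_tensor_space[OF V W]
      vectorspace_tensor_space[OF vectorspace_tensor_space[OF U V] W]
      vectorspace_tensor_space[OF U vectorspace_tensor_space[OF V W]])+

text \<open>
  The spanning sets are arbitrary so that the vectors to be tested can be taken homogeneous.
\<close>

lemma linear_map_eq_on_left_tensors:
  assumes "A \<subseteq> carrier U" "module.span K U A = carrier U"
    and "B \<subseteq> carrier V" "module.span K V B = carrier V"
    and "C \<subseteq> carrier W" "module.span K W C = carrier W"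
    and "linear_map K UV_W X f" "linear_map K UV_W X g"
    and eq: "\<And>u v w. \<lbrakk>u \<in> A; v \<in> B; w \<in> C\<rbrakk> \<Longrightarrow> f (left u v w) = g (left u v w)"
    and x: "x \<in> carrier UV_W"
  shows "f x = g x"
proof (rule linear_map_eq_on_span[OF assms(7,8)])
  let ?AB = "{pure_tensor K U V a b | a b. a \<in> A \<and> b \<in> B}"
  have AB: "?AB \<subseteq> carrier UV" using assms(1,3) by (blast intro: pure_tensor_closed[OF U V])
  then show "{pure_tensor K UV W p c | p c. p \<in> ?AB \<and> c \<in> C} \<subseteq> carrier UV_W"
    using assms(5) pure_tensor_closed[OF vectorspace_triple_tensors(1) W] by blast
  have "module.span K UV ?AB = carrier UV"
    by (rule span_pure_tensors[OF U V assms(1-4)])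
  then show "x \<in> module.span K UV_W {pure_tensor K UV W p c | p c. p \<in> ?AB \<and> c \<in> C}"
    using span_pure_tensors[OF vectorspace_triple_tensors(1) W AB _ assms(5,6)] x by simp
qed (use eq in auto)

lemma linear_map_eq_on_right_tensors:
  assumes "linear_map K U_VW X f" "linear_map K U_VW X g"
    and eq: "\<And>u v w. \<lbrakk>u \<in> carrier U; v \<in> carrier V; w \<in> carrier W\<rbrakk> \<Longrightarrow> f (right u v w) = g (right u v w)"
    and x: "x \<in> carrier U_VW"
  shows "f x = g x"
proof (rule linear_map_eq_on_tensors[OF U vectorspace_triple_tensors(2) assms(1,2) _ x])
  fix u y assume u: "u \<in> carrier U" and y: "y \<in> carrier VW"
  note p = linear_map_pure_tensor(1)[OF U vectorspace_triple_tensors(2) u]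
  have "(f \<circ> pure_tensor K U VW u) y = (g \<circ> pure_tensor K U VW u) y"
    by (rule linear_map_eq_on_tensors[OF V W linear_map_comp[OF p assms(1)]
          linear_map_comp[OF p assms(2)] _ y]) (simp add: eq[OF u])
  then show "f (pure_tensor K U VW u y) = g (pure_tensor K U VW u y)" by simp
qed

lemma tensor_assoc:
  shows "linear_map K UV_W U_VW (tensor_assoc K U V W)"
    and "\<lbrakk>u \<in> carrier U; v \<in> carrier V; w \<in> carrier W\<rbrakk> \<Longrightarrow> tensor_assoc K U V W (left u v w) = right u v w"
proof -
  note T = vectorspace_triple_tensors
  have b: "bilinear_map K U V U_VW (\<lambda>u v. right u v w)" if "w \<in> carrier W" for w
    using bilinear_map_comp[OF bilinear_map_pure_tensor[OF U T(2)] linear_map_id[OF U]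
        linear_map_pure_tensor(2)[OF V W that] linear_map_id[OF T(4)]] by simp
  have lin: "linear_map K W U_VW (\<lambda>w. right u v w)" if "u \<in> carrier U" "v \<in> carrier V" for u v
    using linear_map_comp[OF linear_map_pure_tensor(1)[OF V W that(2)]
        linear_map_pure_tensor(1)[OF U T(2) that(1)]] by (simp add: o_def)
  note bil = bilinear_map_tensor_lift[OF U V W T(4) b lin]
  define h where "h = tensor_lift K UV W U_VW
    (\<lambda>x w. tensor_lift K U V U_VW (\<lambda>u v. right u v w) x)"
  have h: "linear_map K UV_W U_VW h"
    unfolding h_def using tensor_lift(1)[OF T(1) W bil T(4)] .
  have h_left: "h (left u v w) = right u v w" if "u \<in> carrier U" "v \<in> carrier V" "w \<in> carrier W" for u v w
    unfolding h_def using that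
    by (simp add: tensor_lift(2)[OF T(1) W bil T(4)] tensor_lift(2)[OF U V b T(4)] pure_tensor_closed[OF U V])
  have "linear_map K UV_W U_VW (tensor_assoc K U V W) \<and>
    (\<forall>u\<in>carrier U. \<forall>v\<in>carrier V. \<forall>w\<in>carrier W. tensor_assoc K U V W (left u v w) = right u v w)"
    unfolding tensor_assoc_def
  proof (rule the_extensional[where h = h])
    fix g assume "\<And>x. x \<in> carrier UV_W \<Longrightarrow> g x = h x"
    then show "linear_map K UV_W U_VW g \<and>
      (\<forall>u\<in>carrier U. \<forall>v\<in>carrier V. \<forall>w\<in>carrier W. g (left u v w) = right u v w)"
      using h_left linear_map_cong[OF h] pure_tensor_closed[OF U V] pure_tensor_closed[OF T(1) W] by simp
  next
    fix g x assume "linear_map K UV_W U_VW g" "x \<in> carrier UV_W"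
      "\<forall>u\<in>carrier U. \<forall>v\<in>carrier V. \<forall>w\<in>carrier W. g (left u v w) = right u v w"
    then show "g x = h x"
      using linear_map_eq_on_left_tensors[OF subset_refl span_carrier[OF U] subset_refl
            span_carrier[OF V] subset_refl span_carrier[OF W] _ h, of g x] h_left by simp
  qed
  then show "linear_map K UV_W U_VW (tensor_assoc K U V W)"
    "\<lbrakk>u \<in> carrier U; v \<in> carrier V; w \<in> carrier W\<rbrakk> \<Longrightarrow> tensor_assoc K U V W (left u v w) = right u v w"
    by auto
qed

lemma tensor_assoc_inv:
  shows "linear_map K U_VW UV_W (tensor_assoc_inv K U V W)"
    and "\<lbrakk>u \<in> carrier U; v \<in> carrier V; w \<in> carrier W\<rbrakk> \<Longrightarrow> tensor_assoc_inv K U V W (right u v w) = left u v w"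
proof -
  note T = vectorspace_triple_tensors
  have b: "bilinear_map K V W UV_W (\<lambda>v w. left u v w)" if "u \<in> carrier U" for u
    using bilinear_map_comp[OF bilinear_map_pure_tensor[OF T(1) W]
        linear_map_pure_tensor(1)[OF U V that] linear_map_id[OF W] linear_map_id[OF T(3)]] by simp
  have lin: "linear_map K U UV_W (\<lambda>u. left u v w)" if "v \<in> carrier V" "w \<in> carrier W" for v w
    using linear_map_comp[OF linear_map_pure_tensor(2)[OF U V that(1)]
        linear_map_pure_tensor(2)[OF T(1) W that(2)]] by (simp add: o_def)
  note bil = bilinear_map_flip[OF bilinear_map_tensor_lift[OF V W U T(3) b lin]]
  define h where "h = tensor_lift K U VW UV_W
    (\<lambda>u y. tensor_lift K V W UV_W (\<lambda>v w. left u v w) y)"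
  have h: "linear_map K U_VW UV_W h"
    unfolding h_def using tensor_lift(1)[OF U T(2) bil T(3)] .
  have h_right: "h (right u v w) = left u v w" if "u \<in> carrier U" "v \<in> carrier V" "w \<in> carrier W" for u v w
    unfolding h_def using that
    by (simp add: tensor_lift(2)[OF U T(2) bil T(3)] tensor_lift(2)[OF V W b T(3)] pure_tensor_closed[OF V W])
  have "linear_map K U_VW UV_W (tensor_assoc_inv K U V W) \<and>
    (\<forall>u\<in>carrier U. \<forall>v\<in>carrier V. \<forall>w\<in>carrier W. tensor_assoc_inv K U V W (right u v w) = left u v w)"
    unfolding tensor_assoc_inv_def
  proof (rule the_extensional[where h = h])
    fix g assume "\<And>x. x \<in> carrier U_VW \<Longrightarrow> g x = h x"
    then show "linear_map K U_VW UV_W g \<and>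
      (\<forall>u\<in>carrier U. \<forall>v\<in>carrier V. \<forall>w\<in>carrier W. g (right u v w) = left u v w)"
      using h_right linear_map_cong[OF h] pure_tensor_closed[OF V W] pure_tensor_closed[OF U T(2)] by simp
  next
    fix g x assume "linear_map K U_VW UV_W g" "x \<in> carrier U_VW"
      "\<forall>u\<in>carrier U. \<forall>v\<in>carrier V. \<forall>w\<in>carrier W. g (right u v w) = left u v w"
    then show "g x = h x"
      using linear_map_eq_on_right_tensors[OF _ h, of g x] h_right by simp
  qed
  then show "linear_map K U_VW UV_W (tensor_assoc_inv K U V W)"
    "\<lbrakk>u \<in> carrier U; v \<in> carrier V; w \<in> carrier W\<rbrakk> \<Longrightarrow> tensor_assoc_inv K U V W (right u v w) = left u v w"
    by auto
qed

end

section \<open>Components in a direct sum decomposition\<close>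

context
  fixes K :: "'k ring" and V :: "('k, 'v) module" and I :: "'i set" and W :: "'i \<Rightarrow> 'v set"
  assumes V: "vectorspace K V" and decomp: "direct_sum_decomposition K V I W"
begin

interpretation V: vectorspace K V by (rule V)

private abbreviation (input) "cmp v i \<equiv> component V I W v i"
private abbreviation (input) "supp v \<equiv> {i \<in> I. cmp v i \<noteq> \<zero>\<^bsub>V\<^esub>}"

lemma summand_subspace: "i \<in> I \<Longrightarrow> subspace K (W i) V"
  using decomp by (simp add: direct_sum_decomposition_def)

lemma homogeneous_components_component:
  assumes "v \<in> carrier V"
  shows "homogeneous_components V I W v (component V I W v)"
proof -
  have "\<exists>!c. homogeneous_components V I W v c"
    using decomp assms by (simp add: direct_sum_decomposition_def)
  from theI'[OF this] show ?thesis by (simp add: component_def)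
qed

lemma component_in_summand: "\<lbrakk>v \<in> carrier V; i \<in> I\<rbrakk> \<Longrightarrow> cmp v i \<in> W i"
  using homogeneous_components_component by (auto simp: homogeneous_components_def)

lemma component_closed: "\<lbrakk>v \<in> carrier V; i \<in> I\<rbrakk> \<Longrightarrow> cmp v i \<in> carrier V"
  using component_in_summand subspaceD(2)[OF summand_subspace] by blast

lemma finite_support: "v \<in> carrier V \<Longrightarrow> finite (supp v)"
  using homogeneous_components_component by (auto simp: homogeneous_components_def)

lemma sum_over_support:
  assumes U: "vectorspace K U" and "finite A" "A \<subseteq> I" "supp v \<subseteq> A" "v \<in> carrier V"
    and q: "\<And>i. i \<in> I \<Longrightarrow> linear_map K V U (q i)"
  shows "(\<Oplus>\<^bsub>U\<^esub>i\<in>supp v. q i (cmp v i)) = (\<Oplus>\<^bsub>U\<^esub>i\<in>A. q i (cmp v i))"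
proof -
  interpret U: vectorspace K U by (rule U)
  show ?thesis
  proof (rule U.M.add.finprod_mono_neutral_cong_left)
    show "(\<lambda>i. q i (cmp v i)) \<in> A \<rightarrow> carrier U"
      using assms linear_mapD(3)[OF q] component_closed by auto
    show "q i (cmp v i) = \<zero>\<^bsub>U\<^esub>" if "i \<in> A - supp v" for i
      using that assms(3) linear_mapD(6)[OF q, of i] by auto
  qed (use assms in auto)
qed

text \<open>
  Uniqueness of the decomposition, for families indexed by a finite set that may be larger than
  their support.
\<close>

lemma component_eqI:
  assumes c: "\<And>i. i \<in> I \<Longrightarrow> c i \<in> W i" and A: "finite A" "A \<subseteq> I"
    and zero: "\<And>i. i \<in> I - A \<Longrightarrow> c i = \<zero>\<^bsub>V\<^esub>" and v: "v = (\<Oplus>\<^bsub>V\<^esub>i\<in>A. c i)"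
    and i: "i \<in> I"
  shows "cmp v i = c i"
proof -
  have c_closed: "c i \<in> carrier V" if "i \<in> I" for i
    using c subspaceD(2)[OF summand_subspace] that by blast
  have supp: "{i \<in> I. c i \<noteq> \<zero>\<^bsub>V\<^esub>} \<subseteq> A" using zero by auto
  have "(\<Oplus>\<^bsub>V\<^esub>i\<in>{i \<in> I. restrict c I i \<noteq> \<zero>\<^bsub>V\<^esub>}. restrict c I i) = (\<Oplus>\<^bsub>V\<^esub>i\<in>A. c i)"
    using A supp c_closed by (intro V.M.add.finprod_mono_neutral_cong_left) auto
  moreover have "finite {i \<in> I. restrict c I i \<noteq> \<zero>\<^bsub>V\<^esub>}"
    by (rule finite_subset[OF _ A(1)]) (use supp in auto)
  ultimately have "homogeneous_components V I W v (restrict c I)"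
    using c v by (simp add: homogeneous_components_def)
  moreover have v_closed: "v \<in> carrier V"
    unfolding v using c_closed A by (intro V.M.finsum_closed) auto
  ultimately have "component V I W v = restrict c I"
    using homogeneous_components_component[OF v_closed] decomp v_closed
    unfolding direct_sum_decomposition_def by blast
  then show ?thesis using i by simp
qed

lemma sum_of_components:
  assumes "v \<in> carrier V" "finite A" "A \<subseteq> I" "supp v \<subseteq> A"
  shows "v = (\<Oplus>\<^bsub>V\<^esub>i\<in>A. cmp v i)"
proof -
  have "v = (\<Oplus>\<^bsub>V\<^esub>i\<in>supp v. cmp v i)"
    using homogeneous_components_component[OF assms(1)] by (simp add: homogeneous_components_def)
  then show ?thesis
    using sum_over_support[OF V assms(2-4,1), of "\<lambda>_. id"] linear_map_id[OF V] by simp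
qed

text \<open>
  The sums of the components of \<open>v\<close> and \<open>v'\<close> are homogeneous and add up to \<open>v + v'\<close>, so they are its
  components by uniqueness; similarly for scalar multiples.
\<close>

lemma linear_map_component:
  assumes i: "i \<in> I"
  shows "linear_map K V V (\<lambda>v. cmp v i)"
proof (rule linear_mapI[OF V V])
  fix v v' assume v: "v \<in> carrier V" and v': "v' \<in> carrier V"
  let ?A = "supp v \<union> supp v'"
  have A: "finite ?A" "?A \<subseteq> I" using finite_support v v' by auto
  show "cmp (v \<oplus>\<^bsub>V\<^esub> v') i = cmp v i \<oplus>\<^bsub>V\<^esub> cmp v' i"
  proof (rule component_eqI[OF _ A _ _ i])
    have "v \<oplus>\<^bsub>V\<^esub> v' = (\<Oplus>\<^bsub>V\<^esub>i\<in>?A. cmp v i) \<oplus>\<^bsub>V\<^esub> (\<Oplus>\<^bsub>V\<^esub>i\<in>?A. cmp v' i)"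
      using sum_of_components[OF v A] sum_of_components[OF v' A] by simp
    also have "\<dots> = (\<Oplus>\<^bsub>V\<^esub>i\<in>?A. cmp v i \<oplus>\<^bsub>V\<^esub> cmp v' i)"
      using component_closed v v' by (intro V.M.finsum_addf[symmetric]) auto
    finally show "v \<oplus>\<^bsub>V\<^esub> v' = (\<Oplus>\<^bsub>V\<^esub>i\<in>?A. cmp v i \<oplus>\<^bsub>V\<^esub> cmp v' i)" .
  qed (use component_in_summand v v' subspaceD(4)[OF summand_subspace] in auto)
next
  fix c v assume c: "c \<in> carrier K" and v: "v \<in> carrier V"
  show "cmp (c \<odot>\<^bsub>V\<^esub> v) i = c \<odot>\<^bsub>V\<^esub> cmp v i"
  proof (rule component_eqI[OF _ finite_support[OF v] _ _ _ i])
    have "c \<odot>\<^bsub>V\<^esub> v = c \<odot>\<^bsub>V\<^esub> (\<Oplus>\<^bsub>V\<^esub>i\<in>supp v. cmp v i)"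
      using sum_of_components[OF v finite_support[OF v]] by auto
    also have "\<dots> = (\<Oplus>\<^bsub>V\<^esub>i\<in>supp v. c \<odot>\<^bsub>V\<^esub> cmp v i)"
      using component_closed v c by (intro V.finsum_smult) auto
    finally show "c \<odot>\<^bsub>V\<^esub> v = (\<Oplus>\<^bsub>V\<^esub>i\<in>supp v. c \<odot>\<^bsub>V\<^esub> cmp v i)" .
  qed (use component_in_summand v c subspaceD(5)[OF summand_subspace] in auto)
qed (use component_closed i in auto)

lemma component_homogeneous:
  assumes "v \<in> W r" "r \<in> I" "i \<in> I"
  shows "cmp v i = (if i = r then v else \<zero>\<^bsub>V\<^esub>)"
proof (rule component_eqI[of _ "{r}"])
  have "v \<in> carrier V" using assms subspaceD(2)[OF summand_subspace] by blast
  then show "v = (\<Oplus>\<^bsub>V\<^esub>i\<in>{r}. if i = r then v else \<zero>\<^bsub>V\<^esub>)" by simp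
qed (use assms subspaceD(3)[OF summand_subspace] in auto)

lemma span_summands: "module.span K V (\<Union>i\<in>I. W i) = carrier V"
proof (rule span_eq_carrierI[OF V])
  show "(\<Union>i\<in>I. W i) \<subseteq> carrier V" using subspaceD(2)[OF summand_subspace] by blast
next
  fix P assume P: "subspace K P V" and W: "(\<Union>i\<in>I. W i) \<subseteq> P"
  show "carrier V \<subseteq> P"
  proof
    fix v assume v: "v \<in> carrier V"
    have "(\<Oplus>\<^bsub>V\<^esub>i\<in>supp v. cmp v i) \<in> P"
      using component_in_summand v W by (intro subspace_finsum_closed[OF P]) blast
    then show "v \<in> P" using sum_of_components[OF v finite_support[OF v]] by simp
  qed
qed

text \<open>
  The index set depends on \<open>v\<close>, so this is not merely a sum of linear maps; but on any two given
  vectors the sum can be taken over a common finite set.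
\<close>

lemma linear_map_sum_of_components:
  assumes U: "vectorspace K U" and q: "\<And>i. i \<in> I \<Longrightarrow> linear_map K V U (q i)"
  shows "linear_map K V U (\<lambda>v. \<Oplus>\<^bsub>U\<^esub>i\<in>supp v. q i (cmp v i))"
proof -
  interpret U: vectorspace K U by (rule U)
  have lin: "linear_map K V U (\<lambda>v. q i (cmp v i))" if "i \<in> I" for i
    using linear_map_comp[OF linear_map_component q] that by (simp add: o_def)
  have sum: "linear_map K V U (\<lambda>v. \<Oplus>\<^bsub>U\<^esub>i\<in>A. q i (cmp v i))" if "finite A" "A \<subseteq> I" for A
    using that by (intro linear_map_sum lin V U) auto
  show ?thesis
  proof (rule linear_mapI[OF V U])
    fix v assume v: "v \<in> carrier V"
    note S = finite_support[OF v]
    show "(\<Oplus>\<^bsub>U\<^esub>i\<in>supp v. q i (cmp v i)) \<in> carrier U"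
      using linear_mapD(3)[OF sum[OF S] v] by auto
    fix c assume c: "c \<in> carrier K"
    have "supp (c \<odot>\<^bsub>V\<^esub> v) \<subseteq> supp v"
      using c v by (auto simp: linear_mapD(5)[OF linear_map_component])
    then show "(\<Oplus>\<^bsub>U\<^esub>i\<in>supp (c \<odot>\<^bsub>V\<^esub> v). q i (cmp (c \<odot>\<^bsub>V\<^esub> v) i)) =
        c \<odot>\<^bsub>U\<^esub> (\<Oplus>\<^bsub>U\<^esub>i\<in>supp v. q i (cmp v i))"
      using sum_over_support[OF U S _ _ _ q, of "c \<odot>\<^bsub>V\<^esub> v"] linear_mapD(5)[OF sum[OF S] c v] c v by auto
  next
    fix v v' assume v: "v \<in> carrier V" and v': "v' \<in> carrier V"
    let ?A = "supp v \<union> supp v'"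
    have A: "finite ?A" "?A \<subseteq> I" using finite_support v v' by auto
    have "supp (v \<oplus>\<^bsub>V\<^esub> v') \<subseteq> ?A"
      using v v' by (auto simp: linear_mapD(4)[OF linear_map_component])
    then have "(\<Oplus>\<^bsub>U\<^esub>i\<in>supp (v \<oplus>\<^bsub>V\<^esub> v'). q i (cmp (v \<oplus>\<^bsub>V\<^esub> v') i)) =
        (\<Oplus>\<^bsub>U\<^esub>i\<in>?A. q i (cmp (v \<oplus>\<^bsub>V\<^esub> v') i))"
      using v v' by (intro sum_over_support[OF U A] q) auto
    also have "\<dots> = (\<Oplus>\<^bsub>U\<^esub>i\<in>?A. q i (cmp v i)) \<oplus>\<^bsub>U\<^esub> (\<Oplus>\<^bsub>U\<^esub>i\<in>?A. q i (cmp v' i))"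
      by (rule linear_mapD(4)[OF sum[OF A] v v'])
    also have "(\<Oplus>\<^bsub>U\<^esub>i\<in>?A. q i (cmp v i)) = (\<Oplus>\<^bsub>U\<^esub>i\<in>supp v. q i (cmp v i))"
      using v by (intro sum_over_support[OF U A, symmetric] q) auto
    also have "(\<Oplus>\<^bsub>U\<^esub>i\<in>?A. q i (cmp v' i)) = (\<Oplus>\<^bsub>U\<^esub>i\<in>supp v'. q i (cmp v' i))"
      using v' by (intro sum_over_support[OF U A, symmetric] q) auto
    finally show "(\<Oplus>\<^bsub>U\<^esub>i\<in>supp (v \<oplus>\<^bsub>V\<^esub> v'). q i (cmp (v \<oplus>\<^bsub>V\<^esub> v') i)) =
        (\<Oplus>\<^bsub>U\<^esub>i\<in>supp v. q i (cmp v i)) \<oplus>\<^bsub>U\<^esub> (\<Oplus>\<^bsub>U\<^esub>i\<in>supp v'. q i (cmp v' i))" .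
  qed
qed

lemma sum_of_components_homogeneous:
  assumes U: "vectorspace K U" and q: "\<And>i. i \<in> I \<Longrightarrow> linear_map K V U (q i)"
    and r: "r \<in> I" and v: "v \<in> W r"
  shows "(\<Oplus>\<^bsub>U\<^esub>i\<in>supp v. q i (cmp v i)) = q r v"
proof -
  interpret U: vectorspace K U by (rule U)
  have v_closed: "v \<in> carrier V" using v subspaceD(2)[OF summand_subspace[OF r]] by auto
  have "(\<Oplus>\<^bsub>U\<^esub>i\<in>supp v. q i (cmp v i)) = (\<Oplus>\<^bsub>U\<^esub>i\<in>{r}. q i (cmp v i))"
    using r v_closed by (intro sum_over_support[OF U _ _ _ _ q])
      (auto simp: component_homogeneous[OF v r] split: if_splits)
  also have "\<dots> = q r v"
    using linear_mapD(3)[OF q[OF r] v_closed] component_homogeneous[OF v r r] by simp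
  finally show ?thesis .
qed

end

section \<open>The linear braiding\<close>

context
  fixes R :: "'r set" and triR and S :: "'s set" and triS and \<pi> act
    and K :: "'k ring"
    and M :: "('k, 'm) module" and mact and gr
    and M' :: "('k, 'm') module" and mact' and gr'
  assumes rep: "linear_representation R triR S triS \<pi> act K M mact gr"
    and rep': "linear_representation R triR S triS \<pi> act K M' mact' gr'"
begin

interpretation M: linear_representation R triR S triS \<pi> act K M mact gr by (rule rep)
interpretation M': linear_representation R triR S triS \<pi> act K M' mact' gr' by (rule rep')

private abbreviation (input) "M'M \<equiv> tensor_space K M' M"
private abbreviation (input) "\<sigma> \<equiv> linear_braiding R \<pi> K M mact M' gr'"

lemma representation_vectorspaces: "vectorspace K M" "vectorspace K M'" "vectorspace K M'M"
proof -
  show M: "vectorspace K M" by (rule M.vectorspace_axioms)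
  show M': "vectorspace K M'" by (rule M'.vectorspace_axioms)
  show "vectorspace K M'M" by (rule vectorspace_tensor_space[OF M' M])
qed

lemma \<pi>_closed: "r \<in> R \<Longrightarrow> \<pi> r \<in> S"
  using M.maps_to by auto

text \<open>
  For fixed \<open>m'\<close> the index set is fixed and the value is a finite sum of linear maps in \<open>m\<close>.  For fixed
  \<open>m\<close> it is a sum over the components of \<open>m'\<close>.
\<close>

lemma bilinear_map_braiding_value:
  "bilinear_map K M M' M'M (linear_braiding_value R \<pi> K M mact M' gr')"
  unfolding bilinear_map_def linear_braiding_value_def
proof (intro conjI ballI)
  fix m assume m: "m \<in> carrier M"
  show "linear_map K M' M'M (\<lambda>m'. \<Oplus>\<^bsub>M'M\<^esub>r\<in>{r \<in> R. component M' R gr' m' r \<noteq> \<zero>\<^bsub>M'\<^esub>}.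
      pure_tensor K M' M (component M' R gr' m' r) (mact m (\<pi> r)))"
    using m linear_mapD(3)[OF M.mact_linear[OF \<pi>_closed]]
    by (intro linear_map_sum_of_components[OF representation_vectorspaces(2) M'.grading representation_vectorspaces(3),
          where q = "\<lambda>r x. pure_tensor K M' M x (mact m (\<pi> r))"]
        linear_map_pure_tensor(2)[OF representation_vectorspaces(2,1)]) auto
next
  fix m' assume m': "m' \<in> carrier M'"
  show "linear_map K M M'M (\<lambda>m. \<Oplus>\<^bsub>M'M\<^esub>r\<in>{r \<in> R. component M' R gr' m' r \<noteq> \<zero>\<^bsub>M'\<^esub>}.
      pure_tensor K M' M (component M' R gr' m' r) (mact m (\<pi> r)))"
  proof (rule linear_map_sum[OF finite_support[OF representation_vectorspaces(2) M'.grading m'] _ representation_vectorspaces(1,3)])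
    fix r assume "r \<in> {r \<in> R. component M' R gr' m' r \<noteq> \<zero>\<^bsub>M'\<^esub>}"
    then have r: "r \<in> R" by simp
    show "linear_map K M M'M (\<lambda>m. pure_tensor K M' M (component M' R gr' m' r) (mact m (\<pi> r)))"
      using linear_map_comp[OF M.mact_linear[OF \<pi>_closed[OF r]] linear_map_pure_tensor(1)[OF representation_vectorspaces(2,1)
            component_closed[OF representation_vectorspaces(2) M'.grading m' r]]] by (simp add: o_def)
  qed
qed

lemma linear_map_braiding: "linear_map K (tensor_space K M M') M'M \<sigma>"
  unfolding linear_braiding_def
  by (rule tensor_lift(1)[OF representation_vectorspaces(1,2) bilinear_map_braiding_value representation_vectorspaces(3)])

lemma linear_braiding_pure_tensor:
  assumes "m \<in> carrier M" "m' \<in> carrier M'"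
  shows "\<sigma> (pure_tensor K M M' m m') = linear_braiding_value R \<pi> K M mact M' gr' m m'"
  unfolding linear_braiding_def
  by (rule tensor_lift(2)[OF representation_vectorspaces(1,2) bilinear_map_braiding_value representation_vectorspaces(3) assms])

lemma linear_braiding_homogeneous:
  assumes m: "m \<in> carrier M" and r: "r \<in> R" and m': "m' \<in> gr' r"
  shows "\<sigma> (pure_tensor K M M' m m') = pure_tensor K M' M m' (mact m (\<pi> r))"
proof -
  have "m' \<in> carrier M'"
    using m' subspaceD(2)[OF summand_subspace[OF representation_vectorspaces(2) M'.grading r]] by auto
  then have "\<sigma> (pure_tensor K M M' m m') = linear_braiding_value R \<pi> K M mact M' gr' m m'"
    by (rule linear_braiding_pure_tensor[OF m])
  also have "\<dots> = pure_tensor K M' M m' (mact m (\<pi> r))"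
    unfolding linear_braiding_value_def
    using m linear_mapD(3)[OF M.mact_linear[OF \<pi>_closed]]
    by (intro sum_of_components_homogeneous[OF representation_vectorspaces(2) M'.grading representation_vectorspaces(3) _ r m',
          where q = "\<lambda>r x. pure_tensor K M' M x (mact m (\<pi> r))"]
        linear_map_pure_tensor(2)[OF representation_vectorspaces(2,1)]) auto
  finally show ?thesis .
qed

end


section \<open>The Yang--Baxter equation\<close>

lemma set_braided_system:
  fixes M :: "nat \<Rightarrow> 'm set"
  assumes rep: "\<And>i. i \<in> {1..n} \<Longrightarrow> set_representation R triR S triS \<pi> act (M i) (mact i) (gr i)"
  shows "braided_system_set n M (\<lambda>i j. set_braiding \<pi> (mact i) (gr j))"
  unfolding braided_system_set_def
proof (intro conjI allI impI ballI)
  fix i j assume ij: "1 \<le> i \<and> i \<le> j \<and> j \<le> n"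
  interpret Mi: set_representation R triR S triS \<pi> act "M i" "mact i" "gr i" using ij by (intro rep) auto
  interpret Mj: set_representation R triR S triS \<pi> act "M j" "mact j" "gr j" using ij by (intro rep) auto
  show "set_braiding \<pi> (mact i) (gr j) \<in> M i \<times> M j \<rightarrow> M j \<times> M i"
    using Mi.mact_closed Mi.maps_to Mj.gr by (auto simp: set_braiding_def)
next
  fix i j k x assume ijk: "1 \<le> i \<and> i \<le> j \<and> j \<le> k \<and> k \<le> n" and x: "x \<in> (M i \<times> M j) \<times> M k"
  interpret Mi: set_representation R triR S triS \<pi> act "M i" "mact i" "gr i" using ijk by (intro rep) auto
  interpret Mj: set_representation R triR S triS \<pi> act "M j" "mact j" "gr j" using ijk by (intro rep) auto
  interpret Mk: set_representation R triR S triS \<pi> act "M k" "mact k" "gr k" using ijk by (intro rep) auto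
  obtain a b c where abc: "x = ((a, b), c)" "a \<in> M i" "b \<in> M j" "c \<in> M k" using x by auto
  have r: "gr j b \<in> R" "gr k c \<in> R" using Mj.gr Mk.gr abc by auto
  then have s: "\<pi> (gr j b) \<in> S" "\<pi> (gr k c) \<in> S" using Mi.maps_to by auto
  \<comment> \<open>The degree of the vector in the middle changes when it is moved past \<open>c\<close>.\<close>
  have "gr j (mact j b (\<pi> (gr k c))) = act (gr j b) (\<pi> (gr k c))"
    using Mj.graded[OF r(1) s(2)] abc(3) by blast
  then have "mact i (mact i a (\<pi> (gr j b))) (\<pi> (gr k c)) =
      mact i (mact i a (\<pi> (gr k c))) (\<pi> (gr j (mact j b (\<pi> (gr k c)))))"
    using Mi.mact_mact[OF abc(2) s] Mi.\<pi>_act[OF r(1) s(2)] by simp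
  then show "(map_prod (set_braiding \<pi> (mact j) (gr k)) id \<circ> prod_assoc_inv \<circ>
        map_prod id (set_braiding \<pi> (mact i) (gr k)) \<circ> prod_assoc \<circ>
        map_prod (set_braiding \<pi> (mact i) (gr j)) id) x =
      (prod_assoc_inv \<circ> map_prod id (set_braiding \<pi> (mact i) (gr j)) \<circ> prod_assoc \<circ>
        map_prod (set_braiding \<pi> (mact i) (gr k)) id \<circ> prod_assoc_inv \<circ>
        map_prod id (set_braiding \<pi> (mact j) (gr k)) \<circ> prod_assoc) x"
    by (simp add: abc(1) set_braiding_def prod_assoc_def prod_assoc_inv_def)
qed

text \<open>
  On \<open>(u \<otimes> v) \<otimes> w\<close> with \<open>v\<close> of degree \<open>r\<close> and \<open>w\<close> of degree \<open>t\<close> both sides equal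
  \<open>(w \<otimes> v \<cdot> \<pi>(t)) \<otimes> (u \<cdot> \<pi>(r)) \<cdot> \<pi>(t)\<close>.
\<close>

lemma linear_yang_baxter:
  fixes K :: "'k ring" and U :: "('k, 'u) module" and V :: "('k, 'v) module" and W :: "('k, 'w) module"
  assumes repU: "linear_representation R triR S triS \<pi> act K U actU grU"
    and repV: "linear_representation R triR S triS \<pi> act K V actV grV"
    and repW: "linear_representation R triR S triS \<pi> act K W actW grW"
    and x: "x \<in> carrier (tensor_space K (tensor_space K U V) W)"
  defines "\<sigma>UV \<equiv> linear_braiding R \<pi> K U actU V grV"
    and "\<sigma>UW \<equiv> linear_braiding R \<pi> K U actU W grW"
    and "\<sigma>VW \<equiv> linear_braiding R \<pi> K V actV W grW"
  shows "(tensor_map K (tensor_space K V W) U (tensor_space K W V) U \<sigma>VW id \<circ>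
          tensor_assoc_inv K V W U \<circ>
          tensor_map K V (tensor_space K U W) V (tensor_space K W U) id \<sigma>UW \<circ>
          tensor_assoc K V U W \<circ>
          tensor_map K (tensor_space K U V) W (tensor_space K V U) W \<sigma>UV id) x =
         (tensor_assoc_inv K W V U \<circ>
          tensor_map K W (tensor_space K U V) W (tensor_space K V U) id \<sigma>UV \<circ>
          tensor_assoc K W U V \<circ>
          tensor_map K (tensor_space K U W) V (tensor_space K W U) V \<sigma>UW id \<circ>
          tensor_assoc_inv K U W V \<circ>
          tensor_map K U (tensor_space K V W) U (tensor_space K W V) id \<sigma>VW \<circ>
          tensor_assoc K U V W) x" (is "?L x = ?R x")
proof -
  interpret U: linear_representation R triR S triS \<pi> act K U actU grU by (rule repU)
  interpret V: linear_representation R triR S triS \<pi> act K V actV grV by (rule repV)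
  interpret W: linear_representation R triR S triS \<pi> act K W actW grW by (rule repW)
  note U = representation_vectorspaces(1)[OF repU repU] and V = representation_vectorspaces(1)[OF repV repV]
    and W = representation_vectorspaces(1)[OF repW repW]
  note \<sigma>UV = linear_map_braiding[OF repU repV, folded \<sigma>UV_def]
    and \<sigma>UW = linear_map_braiding[OF repU repW, folded \<sigma>UW_def]
    and \<sigma>VW = linear_map_braiding[OF repV repW, folded \<sigma>VW_def]
  note id = linear_map_id[OF U] linear_map_id[OF V] linear_map_id[OF W]
  note maps = tensor_map[OF \<sigma>VW id(1)] tensor_map[OF id(2) \<sigma>UW] tensor_map[OF \<sigma>UV id(3)]
    tensor_map[OF id(3) \<sigma>UV] tensor_map[OF \<sigma>UW id(2)] tensor_map[OF id(1) \<sigma>VW]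
    tensor_assoc[OF V U W] tensor_assoc[OF W U V] tensor_assoc[OF U V W]
    tensor_assoc_inv[OF V W U] tensor_assoc_inv[OF W V U] tensor_assoc_inv[OF U W V]
  note braid = linear_braiding_homogeneous[OF repU repV, folded \<sigma>UV_def]
    linear_braiding_homogeneous[OF repU repW, folded \<sigma>UW_def]
    linear_braiding_homogeneous[OF repV repW, folded \<sigma>VW_def]
  note closed = pure_tensor_closed[OF U V] pure_tensor_closed[OF U W] pure_tensor_closed[OF V W]
    pure_tensor_closed[OF V U] pure_tensor_closed[OF W U] pure_tensor_closed[OF W V]
  let ?T = "tensor_space K (tensor_space K U V) W" and ?T' = "tensor_space K (tensor_space K W V) U"
  have L: "linear_map K ?T ?T' ?L"
    by (rule linear_map_comp maps)+
  have R: "linear_map K ?T ?T' ?R"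
    by (rule linear_map_comp maps)+
  let ?B = "\<Union>r\<in>R. grV r" and ?C = "\<Union>r\<in>R. grW r"
  have B: "?B \<subseteq> carrier V" using subspaceD(2)[OF summand_subspace[OF V V.grading]] by blast
  have C: "?C \<subseteq> carrier W" using subspaceD(2)[OF summand_subspace[OF W W.grading]] by blast
  show ?thesis
  proof (rule linear_map_eq_on_left_tensors[OF U V W subset_refl span_carrier[OF U] B
        span_summands[OF V V.grading] C span_summands[OF W W.grading] L R _ x])
    fix u v w assume u: "u \<in> carrier U" and "v \<in> ?B" "w \<in> ?C"
    then obtain r t where r: "r \<in> R" "v \<in> grV r" and t: "t \<in> R" "w \<in> grW t" by blast
    have v: "v \<in> carrier V" and w: "w \<in> carrier W" using B C r t by auto
    have \<pi>: "\<pi> r \<in> S" "\<pi> t \<in> S" using U.maps_to r t by auto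
    have uS: "actU u' s \<in> carrier U" if "u' \<in> carrier U" "s \<in> S" for u' s
      using linear_mapD(3)[OF U.mact_linear] that by blast
    \<comment> \<open>The right-hand side braids \<open>u \<cdot> \<pi>(t)\<close> past this vector, so its degree is needed.\<close>
    have vt: "actV v (\<pi> t) \<in> grV (act r (\<pi> t))" using V.graded[OF r(1) \<pi>(2)] r(2) by blast
    have rt: "act r (\<pi> t) \<in> R" using U.action.mact_closed r(1) \<pi>(2) by blast
    have \<pi>rt: "\<pi> (act r (\<pi> t)) \<in> S" using U.maps_to rt by auto
    have vt': "actV v (\<pi> t) \<in> carrier V" using vt rt B by blast
    have "actU (actU u (\<pi> r)) (\<pi> t) = actU (actU u (\<pi> t)) (\<pi> (act r (\<pi> t)))"
      using U.mact_mact[OF u \<pi>] U.\<pi>_act[OF r(1) \<pi>(2)] by simp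
    then show "?L (pure_tensor K (tensor_space K U V) W (pure_tensor K U V u v) w) =
        ?R (pure_tensor K (tensor_space K U V) W (pure_tensor K U V u v) w)"
      using u v w uS vt' \<pi> \<pi>rt
      by (simp add: maps[unfolded id_def] id_def closed braid(1)[OF _ r] braid(1)[OF _ rt vt] braid(2)[OF _ t] braid(3)[OF _ t])
  qed
qed

theorem theorem2:
  fixes R :: "'r set" and triR :: "'r \<Rightarrow> 'r \<Rightarrow> 'r"
    and S :: "'s set" and triS :: "'s \<Rightarrow> 's \<Rightarrow> 's"
    and \<pi> :: "'r \<Rightarrow> 's" and act :: "'r \<Rightarrow> 's \<Rightarrow> 'r"
  assumes "shelf_crossed_module R triR S triS \<pi> act"
  shows "(\<forall>(n :: nat) (M :: nat \<Rightarrow> 'm set) (mact :: nat \<Rightarrow> 'm \<Rightarrow> 's \<Rightarrow> 'm) (gr :: nat \<Rightarrow> 'm \<Rightarrow> 'r).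
            (\<forall>i\<in>{1..n}. set_representation R triR S triS \<pi> act (M i) (mact i) (gr i)) \<longrightarrow>
            braided_system_set n M (\<lambda>i j. set_braiding \<pi> (mact i) (gr j))) \<and>
         (\<forall>(K :: 'k ring) (n :: nat) (M :: nat \<Rightarrow> ('k, 'v) module)
            (mact :: nat \<Rightarrow> 'v \<Rightarrow> 's \<Rightarrow> 'v) (gr :: nat \<Rightarrow> 'r \<Rightarrow> 'v set).
            field K \<and>
            (\<forall>i\<in>{1..n}. linear_representation R triR S triS \<pi> act K (M i) (mact i) (gr i)) \<longrightarrow>
            (\<forall>i\<in>{1..n}. \<forall>j\<in>{i..n}. \<forall>m\<in>carrier (M i). \<forall>m'\<in>carrier (M j).
               linear_braiding R \<pi> K (M i) (mact i) (M j) (gr j) (pure_tensor K (M i) (M j) m m') =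
               (\<Oplus>\<^bsub>tensor_space K (M j) (M i)\<^esub>r\<in>{r \<in> R. component (M j) R (gr j) m' r \<noteq> \<zero>\<^bsub>M j\<^esub>}.
                  pure_tensor K (M j) (M i) (component (M j) R (gr j) m' r) (mact i m (\<pi> r)))) \<and>
            braided_system_vect K n M
              (\<lambda>i j. linear_braiding R \<pi> K (M i) (mact i) (M j) (gr j)))"
proof (intro conjI allI impI)
  fix n :: nat and M :: "nat \<Rightarrow> 'm set" and mact :: "nat \<Rightarrow> 'm \<Rightarrow> 's \<Rightarrow> 'm"
    and gr :: "nat \<Rightarrow> 'm \<Rightarrow> 'r"
  assume "\<forall>i\<in>{1..n}. set_representation R triR S triS \<pi> act (M i) (mact i) (gr i)"
  then show "braided_system_set n M (\<lambda>i j. set_braiding \<pi> (mact i) (gr j))"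
    by (intro set_braided_system) auto
next
  fix K :: "'k ring" and n :: nat and M :: "nat \<Rightarrow> ('k, 'v) module"
    and mact :: "nat \<Rightarrow> 'v \<Rightarrow> 's \<Rightarrow> 'v" and gr :: "nat \<Rightarrow> 'r \<Rightarrow> 'v set"
  assume *: "field K \<and> (\<forall>i\<in>{1..n}. linear_representation R triR S triS \<pi> act K (M i) (mact i) (gr i))"
  then have rep: "linear_representation R triR S triS \<pi> act K (M i) (mact i) (gr i)" if "1 \<le> i" "i \<le> n" for i
    using that by auto
  show "\<forall>i\<in>{1..n}. \<forall>j\<in>{i..n}. \<forall>m\<in>carrier (M i). \<forall>m'\<in>carrier (M j).
      linear_braiding R \<pi> K (M i) (mact i) (M j) (gr j) (pure_tensor K (M i) (M j) m m') =
      (\<Oplus>\<^bsub>tensor_space K (M j) (M i)\<^esub>r\<in>{r \<in> R. component (M j) R (gr j) m' r \<noteq> \<zero>\<^bsub>M j\<^esub>}.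
        pure_tensor K (M j) (M i) (component (M j) R (gr j) m' r) (mact i m (\<pi> r)))"
    by (auto simp: linear_braiding_pure_tensor[OF rep rep] linear_braiding_value_def)
  show "braided_system_vect K n M (\<lambda>i j. linear_braiding R \<pi> K (M i) (mact i) (M j) (gr j))"
    unfolding braided_system_vect_def Let_def
  proof (intro conjI allI impI ballI)
    fix i assume "1 \<le> i \<and> i \<le> n"
    then show "vectorspace K (M i)" using representation_vectorspaces(1)[OF rep rep] by blast
  next
    fix i j assume "1 \<le> i \<and> i \<le> j \<and> j \<le> n"
    then show "linear_map K (tensor_space K (M i) (M j)) (tensor_space K (M j) (M i))
        (linear_braiding R \<pi> K (M i) (mact i) (M j) (gr j))"
      using linear_map_braiding[OF rep rep, of i j] by simp
  qed (rule linear_yang_baxter[OF rep rep rep]; simp)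
qed

end
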